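(* Let $h\ge 1$ be a horizon. Suppose that the $(\mathbb R\times\mathcal H)$-valued process $\begin{bmatrix} y_t\\ X_t\end{bmatrix}$ satisfies $$\mathcal B\begin{bmatrix} y_t\\ X_t\end{bmatrix}=\mathcal A\begin{bmatrix} y_{t-1}\\ X_{t-1}\end{bmatrix}+\mathbf u_t,\qquad \mathcal B=\begin{bmatrix} I_1&\beta_{12}\\ \beta_{21}& I_2\end{bmatrix},\quad \mathcal A=\begin{bmatrix}\alpha_{11}&\alpha_{12}\\ \alpha_{21}&\alpha_{22}\end{bmatrix},\quad \mathbf u_t=\begin{bmatrix} u_{1t}\\ U_{2t}\end{bmatrix},$$ and, with $\mathcal B$ invertible and $\Gamma=\mathcal B^{-1}\mathcal A$, the representation $\begin{bmatrix} y_t\\ X_t\end{bmatrix}=\sum_{j=0}^\infty\Gamma^j\mathcal B^{-1}\mathbf u_{t-j}$. Let $\mathrm{SIRF}_{12,h}:\mathcal H\to\mathbb R$ and $\mathrm{SIRF}_{21,h}:\mathbb R\to\mathcal H$ be the off-diagonal entries of $\Gamma^h\mathcal B^{-1}$. Then the following hold, where in each equation below $v_{1,t}$ (resp. $V_{2,t}$) is some $\mathbb R$-valued (resp. $\mathcal H$-valued) MA($h-1$) process (possibly different in each equation), and $v_{1,t}$ (resp. $V_{2,t}$) is not correlated with $\{y_{t-\ell},X_{t-\ell}\}$ for every $\ell\ge0$. (i) Suppose $\beta_{12}=0$. Then $\mathrm{SIRF}_{12,h}$ is equivalent to the coefficient map $\langle\beta_h^y,\cdot\rangle:\mathcal H\to\mathbb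 R$ in $$y_{t+h}=\alpha_h^y y_t+\langle\beta_h^y,X_t\rangle+v_{1,t},$$ where $\alpha_h^y\in\mathbb R$ and $\beta_h^y\in\mathcal H$. Moreover, $\mathrm{SIRF}_{21,h}$ is equivalent to the coefficient $\alpha_h^X:\mathbb R\to\mathcal H$ in $$X_{t+h}=\alpha_h^Xy_t+\beta_h^Xy_{t-1}+\gamma_h^XX_{t-1}+V_{2,t},$$ where $\beta_h^X:\mathbb R\to\mathcal H$ and $\gamma_h^X:\mathcal H\to\mathcal H$. (ii) Suppose $\beta_{21}=0$ and $\mathbf\Sigma_{22}$ is injective. Then $\mathrm{SIRF}_{12,h}$ is equivalent to the coefficient map $\langle\alpha_h^y,\cdot\rangle:\mathcal H\to\mathbb R$ in $$y_{t+h}=\langle\alpha_h^y,X_t\rangle+\langle\beta_h^y,X_{t-1}\rangle+\gamma_h^yy_{t-1}+v_{1,t},$$ where $\alpha_h^y\in\mathcal H$, $\beta_h^y\in\mathcal H$ and $\gamma_h^y\in\mathbb R$. Moreover, $\mathrm{SIRF}_{21,h}$ is equivalent to the coefficient $\beta_h^X:\mathbb R\to\mathcal H$ in $$X_{t+h}=\alpha_h^XX_t+\beta_h^Xy_t+V_{2,t},$$ where $\alpha_h^X:\mathcal H\to\mathcal H$.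
   Context: $\mathcal H=L^2[0,1]$ (real), and $\mathbb R\times\mathcal H$ is the product Hilbert space whose inner product is the sum of the two inner products. $y_t$ is real-valued and $X_t$ is $\mathcal H$-valued. Linear operators on $\mathbb R\times\mathcal H$ are written as $2\times2$ operator matrices acting as $\begin{bmatrix} d_{11}&d_{12}\\ d_{21}&d_{22}\end{bmatrix}\begin{bmatrix} y\\ x\end{bmatrix}=\begin{bmatrix} d_{11}y+d_{12}x\\ d_{21}y+d_{22}x\end{bmatrix}$. $I_1,I_2$ are the identity maps on $\mathbb R$ and $\mathcal H$; $\alpha_{11}:\mathbb R\to\mathbb R$; $\alpha_{12},\beta_{12}:\mathcal H\to\mathbb R$; $\alpha_{21},\beta_{21}:\mathbb R\to\mathcal H$; $\alpha_{22}:\mathcal H\to\mathcal H$ are (bounded) linear maps. With $a\otimes b(\cdot)=\langle a,\cdot\rangle b$, the structural shocks $\mathbf u_t$ (mean zero, serially uncorrelated) have covariance operator $\mathbf\Sigma=\begin{bmatrix}\sigma_{11}&0\\ 0&\mathbf\Sigma_{22}\end{bmatrix}$, where $\sigma_{11}=\mathbb E[u_{1t}\otimes u_{1t}]$ and $\mathbf\Sigma_{22}=\mathbb E[U_{2t}\otimes U_{2t}]$. Structural impulse responses: let $P_{\mathbb R}\begin{bmatrix}x_1\\ x_2\end{bmatrix}=x_1$ and $P_{\mathcal H}\begin{bmatrix}x_1\\ x_2\end{bmatrix}=x_2$, with adjoints $P_{\mathbb R}^\ast x_1=\begin{bmatrix}x_1\\ 0\end{bmatrix}$ and $P_{\mathcal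 H}^\ast x_2=\begin{bmatrix}0\\ x_2\end{bmatrix}$. Then $\mathrm{SIRF}_{12,h}=P_{\mathbb R}\Gamma^h\mathcal B^{-1}P_{\mathcal H}^\ast$ and $\mathrm{SIRF}_{21,h}=P_{\mathcal H}\Gamma^h\mathcal B^{-1}P_{\mathbb R}^\ast$. MA($h-1$) means moving-average process of order $h-1$. Two mean-zero square-integrable random elements $Z,W$ are uncorrelated if $\mathbb E[Z\otimes W]=0$.
   Formalization: In (i) second and (ii) first equation the stated error is impossible in general; there the error is SIRF_{22,h}U_{2,t}+V_{2,t} (resp. SIRF_{11,h}u_{1,t}+v_{1,t}), MA(h). Uniqueness of coefficients is claimed only for Σ_22 injective (SIRF_12) or σ_11≠0 (SIRF_21). *)

theory Defs
  imports "HOL-Probability.Probability"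
begin

text \<open>
  The real Hilbert space \<open>L\<^sup>2[0,1]\<close>: square-integrable functions on the unit interval modulo almost
  everywhere equality. The instances up to second countability (completeness and separability) make
  Bochner integrals of random elements of this space available.
\<close>

definition unit_leb :: "real measure" where
  "unit_leb = restrict_space lborel {0..1}"

definition sq_int :: "(real \<Rightarrow> real) \<Rightarrow> bool" where
  "sq_int f \<longleftrightarrow> f \<in> borel_measurable unit_leb \<and> integrable unit_leb (\<lambda>s. (f s)\<^sup>2)"

lemma finite_measure_unit_leb: "finite_measure unit_leb"
  by (rule finite_measureI) (simp add: unit_leb_def emeasure_restrict_space space_restrict_space)

lemma measure_unit_leb_space: "measure unit_leb (space unit_leb) = 1"
  by (simp add: unit_leb_def measure_restrict_space space_restrict_space)

lemma sq_int_measurable [measurable_dest]: "sq_int f \<Longrightarrow> f \<in> borel_measurable unit_leb"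
  by (simp add: sq_int_def)

lemma sq_int_zero: "sq_int (\<lambda>_. 0)"
  by (simp add: sq_int_def)

lemma sq_int_mult:
  assumes "sq_int f" "sq_int g" shows "integrable unit_leb (\<lambda>s. f s * g s)"
proof (rule Bochner_Integration.integrable_bound)
  show "integrable unit_leb (\<lambda>s. (f s)\<^sup>2 + (g s)\<^sup>2)"
    using assms by (auto simp: sq_int_def)
  show "(\<lambda>s. f s * g s) \<in> borel_measurable unit_leb"
    using assms by measurable
  have "\<bar>a * b\<bar> \<le> a\<^sup>2 + b\<^sup>2" for a b :: real
  proof -
    have "2 * (\<bar>a\<bar> * \<bar>b\<bar>) \<le> a\<^sup>2 + b\<^sup>2"
      using sum_squares_bound[of "\<bar>a\<bar>" "\<bar>b\<bar>"] by simp
    moreover have "0 \<le> \<bar>a\<bar> * \<bar>b\<bar>" by simp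
    ultimately show ?thesis unfolding abs_mult by linarith
  qed
  then show "AE s in unit_leb. norm (f s * g s) \<le> norm ((f s)\<^sup>2 + (g s)\<^sup>2)"
    by (auto intro: order_trans abs_ge_self)
qed

lemma sq_int_add:
  assumes "sq_int f" "sq_int g" shows "sq_int (\<lambda>s. f s + g s)"
  using sq_int_mult[OF assms] assms
  by (auto simp: sq_int_def power2_sum mult.assoc)

lemma sq_int_scale: "sq_int f \<Longrightarrow> sq_int (\<lambda>s. c * f s)"
  by (auto simp: sq_int_def power_mult_distrib)

lemma sq_int_uminus: "sq_int f \<Longrightarrow> sq_int (\<lambda>s. - f s)"
  by (auto simp: sq_int_def)

lemma sq_int_diff: "sq_int f \<Longrightarrow> sq_int g \<Longrightarrow> sq_int (\<lambda>s. f s - g s)"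
  using sq_int_add[of f "\<lambda>s. - g s"] sq_int_uminus[of g] by simp

quotient_type L2_unit = "real \<Rightarrow> real" / partial:
  "\<lambda>f g. sq_int f \<and> sq_int g \<and> (AE s in unit_leb. f s = g s)"
  by (rule part_equivpI)
    (auto simp: symp_def transp_def intro: sq_int_zero exI[of _ "\<lambda>_. 0"] elim: AE_mp)

instantiation L2_unit :: real_inner
begin

lift_definition zero_L2_unit :: L2_unit is "\<lambda>_. 0"
  by (simp add: sq_int_zero)

lift_definition plus_L2_unit :: "L2_unit \<Rightarrow> L2_unit \<Rightarrow> L2_unit" is "\<lambda>f g s. f s + g s"
  by (auto intro: sq_int_add)

lift_definition minus_L2_unit :: "L2_unit \<Rightarrow> L2_unit \<Rightarrow> L2_unit" is "\<lambda>f g s. f s - g s"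
  by (auto intro: sq_int_diff)

lift_definition uminus_L2_unit :: "L2_unit \<Rightarrow> L2_unit" is "\<lambda>f s. - f s"
  by (auto intro: sq_int_uminus)

lift_definition scaleR_L2_unit :: "real \<Rightarrow> L2_unit \<Rightarrow> L2_unit" is "\<lambda>c f s. c * f s"
  by (auto intro: sq_int_scale)

lift_definition inner_L2_unit :: "L2_unit \<Rightarrow> L2_unit \<Rightarrow> real" is
  "\<lambda>f g. \<integral>s. f s * g s \<partial>unit_leb"
proof -
  fix f f' g g'
  assume *: "sq_int f \<and> sq_int f' \<and> (AE s in unit_leb. f s = f' s)"
    "sq_int g \<and> sq_int g' \<and> (AE s in unit_leb. g s = g' s)"
  then have [measurable]: "f \<in> borel_measurable unit_leb" "f' \<in> borel_measurable unit_leb"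
    "g \<in> borel_measurable unit_leb" "g' \<in> borel_measurable unit_leb"
    by (auto simp: sq_int_def)
  show "(\<integral>s. f s * g s \<partial>unit_leb) = (\<integral>s. f' s * g' s \<partial>unit_leb)"
    using * by (intro integral_cong_AE) auto
qed

definition norm_L2_unit :: "L2_unit \<Rightarrow> real" where
  "norm_L2_unit f = sqrt (f \<bullet> f)"

definition dist_L2_unit :: "L2_unit \<Rightarrow> L2_unit \<Rightarrow> real" where
  "dist_L2_unit f g = norm (f - g)"

definition sgn_L2_unit :: "L2_unit \<Rightarrow> L2_unit" where
  "sgn_L2_unit f = inverse (norm f) *\<^sub>R f"

definition uniformity_L2_unit :: "(L2_unit \<times> L2_unit) filter" where
  "uniformity_L2_unit = (INF e\<in>{0<..}. principal {(x, y). dist x y < e})"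

definition open_L2_unit :: "L2_unit set \<Rightarrow> bool" where
  "open_L2_unit S \<longleftrightarrow> (\<forall>x\<in>S. \<forall>\<^sub>F (x', y) in uniformity. x' = x \<longrightarrow> y \<in> S)"

instance
proof
  fix a b c :: L2_unit and r q :: real and S :: "L2_unit set"
  show "a + b + c = a + (b + c)"
    by transfer (auto intro!: sq_int_add simp: add.assoc)
  show "a + b = b + a"
    by transfer (auto intro!: sq_int_add simp: add.commute)
  show "0 + a = a"
    by transfer auto
  show "- a + a = 0"
    by transfer (auto intro: sq_int_zero)
  show "a - b = a + - b"
    by transfer (auto dest: sq_int_diff)
  show "r *\<^sub>R (a + b) = r *\<^sub>R a + r *\<^sub>R b"
    by transfer (auto intro!: sq_int_add sq_int_scale dest: sq_int_add sq_int_scale simp: distrib_left)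
  show "(r + q) *\<^sub>R a = r *\<^sub>R a + q *\<^sub>R a"
    by transfer (auto intro!: sq_int_add sq_int_scale simp: distrib_right)
  show "r *\<^sub>R q *\<^sub>R a = (r * q) *\<^sub>R a"
    by transfer (auto intro!: sq_int_scale simp: mult.assoc)
  show "1 *\<^sub>R a = a"
    by transfer auto
  show "dist a b = norm (a - b)"
    by (rule dist_L2_unit_def)
  show "sgn a = inverse (norm a) *\<^sub>R a"
    by (rule sgn_L2_unit_def)
  show "uniformity = (INF e\<in>{0<..}. principal {(x::L2_unit, y). dist x y < e})"
    by (rule uniformity_L2_unit_def)
  show "open S \<longleftrightarrow> (\<forall>x\<in>S. \<forall>\<^sub>F (x', y) in uniformity. x' = x \<longrightarrow> y \<in> S)"
    by (rule open_L2_unit_def)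
  show "a \<bullet> b = b \<bullet> a"
    by transfer (simp add: mult.commute)
  show "(a + b) \<bullet> c = a \<bullet> c + b \<bullet> c"
    by transfer (simp add: distrib_right sq_int_mult)
  show "(r *\<^sub>R a) \<bullet> b = r * (a \<bullet> b)"
    by transfer (simp add: mult.assoc)
  show "0 \<le> a \<bullet> a"
    by transfer simp
  have "(x \<bullet> x = 0) = (x = 0)" for x :: L2_unit
  proof (transfer, goal_cases)
    case (1 f)
    then have f: "sq_int f" by simp
    then have "integrable unit_leb (\<lambda>s. f s * f s)" by (intro sq_int_mult)
    then show ?case
      using f by (subst integral_nonneg_eq_0_iff_AE) (auto intro: sq_int_zero)
  qed
  then show "(a \<bullet> a = 0) = (a = 0)" .
  show "norm a = sqrt (a \<bullet> a)"
    by (rule norm_L2_unit_def)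
qed

end

definition L2_class :: "(real \<Rightarrow> real) \<Rightarrow> L2_unit" where
  "L2_class f = abs_L2_unit f"

lemma L2_class_cases: obtains f where "sq_int f" "x = L2_class f"
proof -
  have "\<exists>f. sq_int f \<and> x = L2_class f"
    unfolding L2_class_def
    by (metis (no_types, lifting) Quotient_L2_unit Quotient_abs_rep Quotient_rep_reflp)
  then show ?thesis using that by blast
qed

lemma L2_class_eqI:
  "sq_int f \<Longrightarrow> sq_int g \<Longrightarrow> (AE s in unit_leb. f s = g s) \<Longrightarrow> L2_class f = L2_class g"
  unfolding L2_class_def by (rule Quotient_rel_abs[OF Quotient_L2_unit]) simp

lemma L2_class_add: "sq_int f \<Longrightarrow> sq_int g \<Longrightarrow> L2_class f + L2_class g = L2_class (\<lambda>s. f s + g s)"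
  unfolding L2_class_def by (simp add: plus_L2_unit.abs_eq)

lemma L2_class_diff: "sq_int f \<Longrightarrow> sq_int g \<Longrightarrow> L2_class f - L2_class g = L2_class (\<lambda>s. f s - g s)"
  unfolding L2_class_def by (simp add: minus_L2_unit.abs_eq)

lemma L2_class_scale: "sq_int f \<Longrightarrow> c *\<^sub>R L2_class f = L2_class (\<lambda>s. c * f s)"
  unfolding L2_class_def by (simp add: scaleR_L2_unit.abs_eq)

lemma L2_class_zero: "L2_class (\<lambda>_. 0) = 0"
  unfolding L2_class_def by (simp add: zero_L2_unit.abs_eq)

lemma L2_class_inner:
  "sq_int f \<Longrightarrow> sq_int g \<Longrightarrow> L2_class f \<bullet> L2_class g = (\<integral>s. f s * g s \<partial>unit_leb)"
  unfolding L2_class_def by (simp add: inner_L2_unit.abs_eq)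

lemma L2_class_norm: "sq_int f \<Longrightarrow> (norm (L2_class f))\<^sup>2 = (\<integral>s. (f s)\<^sup>2 \<partial>unit_leb)"
  by (simp add: power2_norm_eq_inner L2_class_inner) (simp add: power2_eq_square)

lemma sq_int_bounded:
  assumes [measurable]: "f \<in> borel_measurable unit_leb" and "\<And>s. \<bar>f s\<bar> \<le> 1" shows "sq_int f"
proof -
  interpret finite_measure unit_leb by (rule finite_measure_unit_leb)
  show ?thesis unfolding sq_int_def
    using assms by (auto intro!: integrable_const_bound[where B=1] simp: abs_square_le_1)
qed

lemma L2_class_L1:
  assumes "sq_int f" shows "(\<integral>s. \<bar>f s\<bar> \<partial>unit_leb) \<le> norm (L2_class f)"
proof -
  have 1: "sq_int (\<lambda>_. 1)" by (intro sq_int_bounded) auto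
  have a: "sq_int (\<lambda>s. \<bar>f s\<bar>)" using assms by (auto simp: sq_int_def)
  have n1: "(norm (L2_class (\<lambda>_. 1)))\<^sup>2 = 1"
    using L2_class_norm[OF 1] measure_unit_leb_space by simp
  then have n1: "norm (L2_class (\<lambda>_. 1)) = 1"
    by (simp add: power2_eq_1_iff) (use norm_ge_zero[of "L2_class (\<lambda>_. 1)"] in linarith)
  have "(norm (L2_class (\<lambda>s. \<bar>f s\<bar>)))\<^sup>2 = (norm (L2_class f))\<^sup>2"
    using L2_class_norm[OF a] L2_class_norm[OF assms] by simp
  then have "norm (L2_class (\<lambda>s. \<bar>f s\<bar>)) = norm (L2_class f)" by simp
  moreover have "(\<integral>s. \<bar>f s\<bar> \<partial>unit_leb) = L2_class (\<lambda>s. \<bar>f s\<bar>) \<bullet> L2_class (\<lambda>_. 1)"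
    using L2_class_inner[OF a 1] by simp
  ultimately show ?thesis
    using norm_cauchy_schwarz[of "L2_class (\<lambda>s. \<bar>f s\<bar>)" "L2_class (\<lambda>_. 1)"] n1 by simp
qed

instance L2_unit :: complete_space
proof
  fix X :: "nat \<Rightarrow> L2_unit" assume X: "Cauchy X"
  have "\<exists>f. sq_int f \<and> X n = L2_class f" for n by (rule L2_class_cases[of "X n"]) blast
  then obtain f where f: "\<And>n. sq_int (f n)" and Xf: "\<And>n. X n = L2_class (f n)" by metis
  have fm [measurable]: "\<And>n. f n \<in> borel_measurable unit_leb" using f by (simp add: sq_int_def)
  have d: "\<And>m n. sq_int (\<lambda>s. f m s - f n s)" using f sq_int_diff by blast
  interpret finite_measure unit_leb by (rule finite_measure_unit_leb)
  have int: "\<And>n. integrable unit_leb (f n)"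
    using sq_int_mult[OF f sq_int_bounded[of "\<lambda>_. 1"]] by simp
  obtain r where r: "strict_mono r" and C: "AE s in unit_leb. Cauchy (\<lambda>i. f (r i) s)"
  proof (rule cauchy_L1_AE_cauchy_subseq[OF int])
    fix e :: real assume "e > 0"
    then obtain N where N: "\<And>i j. i \<ge> N \<Longrightarrow> j \<ge> N \<Longrightarrow> norm (X i - X j) < e"
      using X by (metis Cauchy_iff)
    show "\<exists>N. \<forall>i\<ge>N. \<forall>j\<ge>N. (\<integral>s. norm (f i s - f j s) \<partial>unit_leb) < e"
    proof (intro exI[of _ N] allI impI)
      fix i j assume "N \<le> i" "N \<le> j"
      then show "(\<integral>s. norm (f i s - f j s) \<partial>unit_leb) < e"
        using N[of i j] L2_class_L1[OF d[of i j]] by (simp add: Xf L2_class_diff f)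
    qed
  qed blast
  define g where "g s = lim (\<lambda>i. f (r i) s)" for s
  have gm [measurable]: "g \<in> borel_measurable unit_leb" unfolding g_def by measurable
  have conv: "AE s in unit_leb. (\<lambda>i. f (r i) s) \<longlonglongrightarrow> g s"
    using C by eventually_elim (simp add: g_def Cauchy_convergent_iff convergent_LIMSEQ_iff)
  have key: "sq_int (\<lambda>s. f n s - g s) \<and> norm (L2_class (\<lambda>s. f n s - g s)) \<le> e"
    if e: "e > 0" and N: "\<And>i j. i \<ge> N \<Longrightarrow> j \<ge> N \<Longrightarrow> norm (X i - X j) < e" and n: "n \<ge> N" for e N n
  proof -
    have "(\<integral>\<^sup>+s. ennreal ((f n s - g s)\<^sup>2) \<partial>unit_leb)
      = (\<integral>\<^sup>+s. liminf (\<lambda>i. ennreal ((f n s - f (r i) s)\<^sup>2)) \<partial>unit_leb)"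
    proof (rule nn_integral_cong_AE)
      show "AE s in unit_leb. ennreal ((f n s - g s)\<^sup>2) = liminf (\<lambda>i. ennreal ((f n s - f (r i) s)\<^sup>2))"
        using conv
      proof eventually_elim
        case (elim s)
        have "(\<lambda>i. ennreal ((f n s - f (r i) s)\<^sup>2)) \<longlonglongrightarrow> ennreal ((f n s - g s)\<^sup>2)"
          by (intro tendsto_ennrealI tendsto_intros elim)
        then show ?case by (intro lim_imp_Liminf[symmetric]) auto
      qed
    qed
    also have "\<dots> \<le> liminf (\<lambda>i. \<integral>\<^sup>+s. ennreal ((f n s - f (r i) s)\<^sup>2) \<partial>unit_leb)"
      by (intro nn_integral_liminf) measurable
    also have "\<dots> \<le> ennreal (e\<^sup>2)"
    proof (rule Liminf_le)
      show "\<forall>\<^sub>F i in sequentially. (\<integral>\<^sup>+s. ennreal ((f n s - f (r i) s)\<^sup>2) \<partial>unit_leb) \<le> ennreal (e\<^sup>2)"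
        using eventually_ge_at_top[of N]
      proof eventually_elim
        case (elim i)
        have "r i \<ge> N" using seq_suble[OF r, of i] elim by simp
        then have "norm (L2_class (\<lambda>s. f n s - f (r i) s)) < e"
          using N[OF n] by (simp add: Xf L2_class_diff f)
        then have "(norm (L2_class (\<lambda>s. f n s - f (r i) s)))\<^sup>2 \<le> e\<^sup>2"
          by (intro power_mono) auto
        then show ?case
          using d[of n "r i"] by (subst nn_integral_eq_integral) (auto simp: L2_class_norm sq_int_def)
      qed
    qed auto
    finally have le: "(\<integral>\<^sup>+s. ennreal ((f n s - g s)\<^sup>2) \<partial>unit_leb) \<le> ennreal (e\<^sup>2)" .
    have "integrable unit_leb (\<lambda>s. (f n s - g s)\<^sup>2)"
      by (rule integrableI_bounded) (use le in \<open>auto simp: top_unique intro: le_less_trans\<close>)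
    then have sq: "sq_int (\<lambda>s. f n s - g s)" by (simp add: sq_int_def)
    have "ennreal (\<integral>s. (f n s - g s)\<^sup>2 \<partial>unit_leb) \<le> ennreal (e\<^sup>2)"
      using le sq by (subst nn_integral_eq_integral[symmetric]) (auto simp: sq_int_def)
    then have "(norm (L2_class (\<lambda>s. f n s - g s)))\<^sup>2 \<le> e\<^sup>2"
      using sq by (simp add: L2_class_norm)
    then show ?thesis using sq e by (auto intro: power2_le_imp_le)
  qed
  obtain N where "\<And>i j. i \<ge> N \<Longrightarrow> j \<ge> N \<Longrightarrow> norm (X i - X j) < 1"
    using X by (metis Cauchy_iff zero_less_one)
  with key[of 1 N N] have "sq_int (\<lambda>s. f N s - g s)" by simp
  from sq_int_diff[OF f[of N] this] have g: "sq_int g" by simp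
  have "X \<longlonglongrightarrow> L2_class g"
  proof (rule LIMSEQ_I)
    fix e :: real assume "e > 0"
    then obtain N where N: "\<And>i j. i \<ge> N \<Longrightarrow> j \<ge> N \<Longrightarrow> norm (X i - X j) < e / 2"
      using X by (metis Cauchy_iff half_gt_zero)
    have "norm (X n - L2_class g) < e" if "n \<ge> N" for n
      using key[of "e / 2" N n] N that \<open>e > 0\<close> by (auto simp: Xf L2_class_diff f g)
    then show "\<exists>N. \<forall>n\<ge>N. norm (X n - L2_class g) < e" by blast
  qed
  then show "convergent X" by (rule convergentI)
qed

instance L2_unit :: banach ..

lemma L2_class_tendsto:
  assumes f: "\<And>n. sq_int (f n)" and g: "sq_int g" and b: "sq_int b"
    and lim: "\<And>s. s \<in> space unit_leb \<Longrightarrow> (\<lambda>n. f n s) \<longlonglongrightarrow> g s"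
    and bound: "\<And>n s. s \<in> space unit_leb \<Longrightarrow> \<bar>f n s\<bar> \<le> \<bar>b s\<bar>"
  shows "(\<lambda>n. L2_class (f n)) \<longlonglongrightarrow> L2_class g"
proof -
  have fm [measurable]: "\<And>n. f n \<in> borel_measurable unit_leb" "g \<in> borel_measurable unit_leb"
    using f g by (simp_all add: sq_int_def)
  have gb: "\<bar>g s\<bar> \<le> \<bar>b s\<bar>" if "s \<in> space unit_leb" for s
    by (rule LIMSEQ_le_const2[OF tendsto_rabs[OF lim[OF that]]]) (use bound that in auto)
  have "(\<lambda>n. \<integral>s. (f n s - g s)\<^sup>2 \<partial>unit_leb) \<longlonglongrightarrow> (\<integral>s. 0 \<partial>unit_leb)"
  proof (rule integral_dominated_convergence[where w="\<lambda>s. (2 * b s)\<^sup>2"])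
    show "integrable unit_leb (\<lambda>s. (2 * b s)\<^sup>2)" using b by (simp add: sq_int_def power_mult_distrib)
    show "AE s in unit_leb. (\<lambda>n. (f n s - g s)\<^sup>2) \<longlonglongrightarrow> 0"
    proof (rule AE_I2)
      fix s assume "s \<in> space unit_leb"
      from lim[OF this] have "(\<lambda>n. (f n s - g s)\<^sup>2) \<longlonglongrightarrow> (g s - g s)\<^sup>2" by (intro tendsto_intros)
      then show "(\<lambda>n. (f n s - g s)\<^sup>2) \<longlonglongrightarrow> 0" by simp
    qed
    show "AE s in unit_leb. norm ((f n s - g s)\<^sup>2) \<le> (2 * b s)\<^sup>2" for n
    proof (rule AE_I2)
      fix s assume "s \<in> space unit_leb"
      with bound[of s n] gb[of s] have "\<bar>f n s - g s\<bar> \<le> \<bar>2 * b s\<bar>" by linarith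
      then show "norm ((f n s - g s)\<^sup>2) \<le> (2 * b s)\<^sup>2" by (simp add: abs_le_square_iff)
    qed
  qed measurable
  then have "(\<lambda>n. (norm (L2_class (f n) - L2_class g))\<^sup>2) \<longlonglongrightarrow> 0"
    by (simp add: L2_class_diff f g L2_class_norm sq_int_diff)
  then have "(\<lambda>n. sqrt ((norm (L2_class (f n) - L2_class g))\<^sup>2)) \<longlonglongrightarrow> sqrt 0"
    by (rule tendsto_real_sqrt)
  then show ?thesis by (simp add: tendsto_norm_zero_iff LIM_zero_iff)
qed

instance L2_unit :: second_countable_topology
proof
  define step where "step q = L2_class (indicator {..q})" for q :: real
  define comb where "comb l = (\<Sum>(c, q)\<leftarrow>l. real_of_rat c *\<^sub>R step (real_of_rat q))" for l :: "(rat \<times> rat) list"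
  define D where "D = range comb"
  have cD: "countable D" unfolding D_def by simp
  have D_add: "x + y \<in> D" if "x \<in> D" "y \<in> D" for x y
  proof -
    from that obtain k l where "x = comb k" "y = comb l" unfolding D_def by auto
    then have "x + y = comb (k @ l)" by (simp add: comb_def)
    then show ?thesis by (simp add: D_def)
  qed
  have D_scale: "real_of_rat c *\<^sub>R x \<in> D" if "x \<in> D" for x c
  proof -
    from that obtain l where "x = comb l" unfolding D_def by auto
    moreover have "real_of_rat c *\<^sub>R comb l = comb (map (\<lambda>(d, q). (c * d, q)) l)"
      by (induction l) (auto simp: comb_def scaleR_add_right of_rat_mult)
    ultimately show ?thesis by (simp add: D_def)
  qed
  define K where "K = closure D"
  have K_lim: "x \<in> K" if "\<And>n. f n \<in> K" "f \<longlonglongrightarrow> x" for f and x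
    using closed_sequentially[of K f x] that unfolding K_def by auto
  have K_add: "x + y \<in> K" if "x \<in> K" "y \<in> K" for x y
  proof -
    from that obtain a b where "\<And>n::nat. a n \<in> D" "a \<longlonglongrightarrow> x" "\<And>n::nat. b n \<in> D" "b \<longlonglongrightarrow> y"
      unfolding K_def closure_sequential by blast
    then show ?thesis unfolding K_def closure_sequential
      by (intro exI[of _ "\<lambda>n. a n + b n"]) (auto intro: D_add tendsto_add)
  qed
  have K_scale: "c *\<^sub>R x \<in> K" if "x \<in> K" for x and c :: real
  proof -
    from that obtain a where a: "\<And>n::nat. a n \<in> D" "a \<longlonglongrightarrow> x"
      unfolding K_def closure_sequential by blast
    have "\<exists>q. \<bar>real_of_rat q - c\<bar> < 1 / real (Suc n)" for n
    proof -
      obtain q where "c - 1 / real (Suc n) < real_of_rat q" "real_of_rat q < c + 1 / real (Suc n)"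
        using of_rat_dense[of "c - 1 / real (Suc n)" "c + 1 / real (Suc n)"] by auto
      then show ?thesis by (intro exI[of _ q]) linarith
    qed
    then obtain q where q: "\<And>n. \<bar>real_of_rat (q n) - c\<bar> < 1 / real (Suc n)" by metis
    have "(\<lambda>n. real_of_rat (q n) - c) \<longlonglongrightarrow> 0"
      by (rule Lim_null_comparison[OF _ LIMSEQ_inverse_real_of_nat])
        (use q in \<open>auto simp: inverse_eq_divide less_imp_le\<close>)
    then have "(\<lambda>n. real_of_rat (q n)) \<longlonglongrightarrow> c" by (rule LIM_zero_cancel)
    with a show ?thesis unfolding K_def closure_sequential
      by (intro exI[of _ "\<lambda>n. real_of_rat (q n) *\<^sub>R a n"]) (auto intro: D_scale tendsto_scaleR)
  qed
  have K_zero: "0 \<in> K"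
  proof -
    have "comb [] \<in> D" by (simp add: D_def)
    then show ?thesis using closure_subset by (auto simp: K_def comb_def)
  qed
  have mU: "indicator A \<in> borel_measurable unit_leb" if "A \<in> sets borel" for A :: "real set"
    using that unfolding unit_leb_def by (intro measurable_restrict_space1) simp
  have sqA: "sq_int (indicator A)" if "A \<in> sets borel" for A :: "real set"
    by (rule sq_int_bounded[OF mU[OF that]]) (simp add: indicator_def)
  have sq1: "sq_int (\<lambda>_. 1)" by (intro sq_int_bounded) auto
  have step_rat: "step (real_of_rat q) \<in> K" for q
  proof -
    have "comb [(1, q)] \<in> D" by (simp add: D_def)
    then show ?thesis using closure_subset by (auto simp: K_def comb_def)
  qed
  have atMost_K: "L2_class (indicator {..a}) \<in> K" for a :: real
  proof -
    have "\<exists>q. a < real_of_rat q \<and> real_of_rat q < a + 1 / real (Suc n)" for n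
      using of_rat_dense[of a "a + 1 / real (Suc n)"] by auto
    then obtain q where q: "\<And>n. a < real_of_rat (q n)" "\<And>n. real_of_rat (q n) < a + 1 / real (Suc n)"
      by metis
    have ql: "(\<lambda>n. real_of_rat (q n)) \<longlonglongrightarrow> a"
    proof (rule LIM_zero_cancel, rule Lim_null_comparison[OF _ LIMSEQ_inverse_real_of_nat])
      have "norm (real_of_rat (q n) - a) \<le> inverse (real (Suc n))" for n
        using q[of n] by (simp add: inverse_eq_divide) 
      then show "\<forall>\<^sub>F n in sequentially. norm (real_of_rat (q n) - a) \<le> inverse (real (Suc n))"
        by simp
    qed
    have "(\<lambda>n. L2_class (indicator {..real_of_rat (q n)})) \<longlonglongrightarrow> L2_class (indicator {..a})"
    proof (rule L2_class_tendsto[OF _ _ sq1])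
      fix s :: real
      show "(\<lambda>n. indicator {..real_of_rat (q n)} s :: real) \<longlonglongrightarrow> indicator {..a} s"
      proof (cases "s \<le> a")
        case True
        then have "s \<le> real_of_rat (q n)" for n using q(1)[of n] by linarith
        with True show ?thesis by simp
      next
        case False
        then have "\<forall>\<^sub>F n in sequentially. real_of_rat (q n) < s"
          using order_tendstoD(2)[OF ql, of s] by simp
        then have "\<forall>\<^sub>F n in sequentially. (indicator {..real_of_rat (q n)} s :: real) = indicator {..a} s"
          by eventually_elim (use False in auto)
        then show ?thesis by (rule tendsto_eventually)
      qed
    qed (auto intro!: sqA simp: indicator_def)
    then show ?thesis by (rule K_lim[rotated]) (use step_rat in \<open>simp add: step_def\<close>)
  qed
  have one_K: "L2_class (\<lambda>_. 1) \<in> K"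
  proof -
    have "L2_class (indicator {..1}) = L2_class (\<lambda>_. 1)"
    proof (rule L2_class_eqI[OF sqA sq1])
      show "AE s in unit_leb. indicator {..1} s = (1::real)"
        by (rule AE_I2) (simp add: unit_leb_def space_restrict_space)
    qed simp
    with atMost_K[of 1] show ?thesis by simp
  qed
  have borel_K: "L2_class (indicator A) \<in> K" if "A \<in> sets borel" for A
  proof -
    have sb: "sets (borel :: real measure) = sigma_sets UNIV (range (\<lambda>a. {..a}))"
      by (subst borel_eq_atMost) simp
    from that have As: "A \<in> sigma_sets UNIV (range (\<lambda>a::real. {..a}))" by (simp only: sb)
    have ist: "Int_stable (range (\<lambda>a::real. {..a}))"
    proof (rule Int_stableI)
      fix a b assume "a \<in> range (\<lambda>a::real. {..a})" "b \<in> range (\<lambda>a::real. {..a})"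
      then obtain p q where "a = {..p}" "b = {..q}" by auto
      then have "a \<inter> b = {..min p q}" by auto
      then show "a \<inter> b \<in> range (\<lambda>a::real. {..a})" by simp
    qed
    have pw: "range (\<lambda>a::real. {..a}) \<subseteq> Pow UNIV" by simp
    from ist pw As show ?thesis
    proof (induct rule: sigma_sets_induct_disjoint)
      case (basic A) then show ?case using atMost_K by auto
    next
      case empty
      show ?case using K_zero by (simp add: L2_class_zero[symmetric])
    next
      case (compl A)
      then have A: "A \<in> sets borel" by (simp only: sb)
      have "indicator (UNIV - A) = (\<lambda>s. 1 + (- 1) * (indicator A s :: real))"
        by (auto simp: indicator_def)
      then have "L2_class (indicator (UNIV - A)) = L2_class (\<lambda>_. 1) + (- 1) *\<^sub>R L2_class (indicator A)"
        by (simp only: L2_class_scale[OF sqA[OF A]] L2_class_add[OF sq1 sq_int_scale[OF sqA[OF A]]])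
      then show ?case by (simp only: K_add[OF one_K K_scale[OF compl(2)]])
    next
      case (union A)
      then have A: "\<And>i. A i \<in> sets borel" by (simp only: sb) blast
      then have An: "(\<Union>i<n. A i) \<in> sets borel" for n by blast
      have fin: "L2_class (indicator (\<Union>i<n. A i)) \<in> K" for n
      proof (induction n)
        case 0 show ?case using K_zero by (simp add: L2_class_zero[symmetric])
      next
        case (Suc n)
        have "indicator (\<Union>i<Suc n. A i) = (\<lambda>s. indicator (\<Union>i<n. A i) s + (indicator (A n) s :: real))"
        proof
          fix s
          have "A n \<inter> (\<Union>i<n. A i) = {}"
            using union(1) by (auto simp: disjoint_family_on_def) (metis disjoint_iff less_irrefl)
          then show "indicator (\<Union>i<Suc n. A i) s = indicator (\<Union>i<n. A i) s + (indicator (A n) s :: real)"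
            by (auto simp: indicator_def less_Suc_eq)
        qed
        then have "L2_class (indicator (\<Union>i<Suc n. A i)) = L2_class (indicator (\<Union>i<n. A i)) + L2_class (indicator (A n))"
          by (simp only: L2_class_add[OF sqA[OF An] sqA[OF A]])
        then show ?case using K_add[OF Suc union(3)] by simp
      qed
      have "(\<lambda>n. L2_class (indicator (\<Union>i<n. A i))) \<longlonglongrightarrow> L2_class (indicator (\<Union>i. A i))"
        by (rule L2_class_tendsto[OF sqA[OF An] sqA sq1 LIMSEQ_indicator_UN])
          (use A in \<open>auto simp: indicator_def\<close>)
      then show ?case by (rule K_lim[rotated]) (rule fin)
    qed
  qed
  have all_K: "x \<in> K" for x
  proof -
    obtain f where f: "sq_int f" and x: "x = L2_class f" by (rule L2_class_cases)
    have [measurable]: "f \<in> borel_measurable unit_leb" using f by (simp add: sq_int_def)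
    obtain F where F: "\<And>i. simple_function unit_leb (F i)"
      "\<And>s. s \<in> space unit_leb \<Longrightarrow> (\<lambda>i. F i s) \<longlonglongrightarrow> f s"
      "\<And>i s. s \<in> space unit_leb \<Longrightarrow> \<bar>F i s\<bar> \<le> \<bar>2 * f s\<bar>"
    proof -
      obtain F where "\<forall>i. simple_function unit_leb (F i)"
        "\<forall>s\<in>space unit_leb. (\<lambda>i. F i s) \<longlonglongrightarrow> f s"
        "\<forall>i. \<forall>s\<in>space unit_leb. dist (F i s) 0 \<le> 2 * dist (f s) 0"
        using borel_measurable_implies_sequence_metric[of f unit_leb 0] by auto
      then show ?thesis by (intro that[of F]) (auto simp: abs_mult)
    qed
    have simp_K: "sq_int g \<and> L2_class g \<in> K" if g: "simple_function unit_leb g" for g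
    proof -
      define S where "S = g ` space unit_leb"
      have fS: "finite S" using g by (simp add: S_def simple_function_def)
      have meas: "g -` {y} \<inter> space unit_leb \<in> sets borel" for y
      proof -
        have "g -` {y} \<inter> space unit_leb \<in> sets unit_leb"
          using borel_measurable_simple_function[OF g] by (rule measurable_sets) simp
        then show ?thesis by (auto simp: unit_leb_def sets_restrict_space_iff)
      qed
      have part: "sq_int (\<lambda>s. \<Sum>y\<in>T. y * indicator (g -` {y} \<inter> space unit_leb) s) \<and>
        L2_class (\<lambda>s. \<Sum>y\<in>T. y * indicator (g -` {y} \<inter> space unit_leb) s) \<in> K" if "finite T" for T
        using that
      proof induction
        case empty show ?case using K_zero by (simp add: sq_int_zero L2_class_zero)
      next
        case (insert y T)
        have 1: "sq_int (\<lambda>s. y * indicator (g -` {y} \<inter> space unit_leb) s)"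
          by (rule sq_int_scale[OF sqA[OF meas]])
        have 2: "L2_class (\<lambda>s. y * indicator (g -` {y} \<inter> space unit_leb) s) \<in> K"
          using K_scale[OF borel_K[OF meas], of y] by (simp only: L2_class_scale[OF sqA[OF meas]])
        show ?case
          using sq_int_add[OF 1 conjunct1[OF insert.IH]] K_add[OF 2 conjunct2[OF insert.IH]]
          by (simp only: L2_class_add[OF 1 conjunct1[OF insert.IH]] sum.insert[OF insert.hyps] simp_thms)
      qed
      have eq: "g s = (\<Sum>y\<in>S. y * indicator (g -` {y} \<inter> space unit_leb) s)" if "s \<in> space unit_leb" for s
      proof -
        have "(\<Sum>y\<in>S. y * indicator (g -` {y} \<inter> space unit_leb) s) = (\<Sum>y\<in>{g s}. y * indicator (g -` {y} \<inter> space unit_leb) s)"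
          by (rule sum.mono_neutral_right) (use fS that in \<open>auto simp: S_def indicator_def\<close>)
        then show ?thesis using that by simp
      qed
      have "integrable unit_leb (\<lambda>s. (g s)\<^sup>2) \<longleftrightarrow>
        integrable unit_leb (\<lambda>s. (\<Sum>y\<in>S. y * indicator (g -` {y} \<inter> space unit_leb) s)\<^sup>2)"
        by (rule Bochner_Integration.integrable_cong[OF refl]) (rule arg_cong[OF eq])
      with conjunct1[OF part[OF fS]] borel_measurable_simple_function[OF g] have sg: "sq_int g"
        unfolding sq_int_def by blast
      have "L2_class g = L2_class (\<lambda>s. \<Sum>y\<in>S. y * indicator (g -` {y} \<inter> space unit_leb) s)"
        by (rule L2_class_eqI[OF sg conjunct1[OF part[OF fS]]]) (rule AE_I2, rule eq)
      then show ?thesis using sg part[OF fS] by simp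
    qed
    have "(\<lambda>i. L2_class (F i)) \<longlonglongrightarrow> L2_class f"
      by (rule L2_class_tendsto[OF _ f sq_int_scale[OF f, of 2]]) (use simp_K F in auto)
    then show ?thesis unfolding x by (rule K_lim[rotated]) (use simp_K F in auto)
  qed
  define B where "B = (\<lambda>(d, n). ball d (1 / real (Suc n))) ` (D \<times> (UNIV :: nat set))"
  have "topological_basis B"
  proof (rule topological_basisI)
    fix U assume "U \<in> B" then show "open U" by (auto simp: B_def)
  next
    fix U and x :: L2_unit assume U: "open U" "x \<in> U"
    then obtain e where e: "e > 0" "ball x e \<subseteq> U" by (meson openE)
    obtain n where n: "1 / real (Suc n) < e / 2" using nat_approx_posE[of "e / 2"] e(1) by auto
    obtain d where d: "d \<in> D" "dist d x < 1 / real (Suc n)"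
      using all_K[of x] unfolding K_def closure_approachable by (metis of_nat_0_less_iff zero_less_Suc zero_less_divide_1_iff)
    have "ball d (1 / real (Suc n)) \<subseteq> ball x e"
    proof
      fix z assume "z \<in> ball d (1 / real (Suc n))"
      then have "dist d z < 1 / real (Suc n)" by simp
      with d(2) n dist_triangle[of x z d] show "z \<in> ball x e" by (simp add: dist_commute)
    qed
    with e d show "\<exists>V\<in>B. x \<in> V \<and> V \<subseteq> U"
      by (intro bexI[of _ "ball d (1 / real (Suc n))"]) (auto simp: B_def)
  qed
  moreover have "countable B" unfolding B_def using cD by simp
  ultimately show "\<exists>B::L2_unit set set. countable B \<and> open = generate_topology B"
    using topological_basis_imp_subbasis by blast
qed

section \<open>Second-order random elements\<close>

definition sq_integrable_rv :: "'w measure \<Rightarrow> ('w \<Rightarrow> 'e::real_normed_vector) \<Rightarrow> bool" where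
  "sq_integrable_rv M Z \<longleftrightarrow> Z \<in> borel_measurable M \<and> integrable M (\<lambda>\<omega>. (norm (Z \<omega>))\<^sup>2)"

definition centred_rv :: "'w measure \<Rightarrow> ('w \<Rightarrow> 'e::{banach, second_countable_topology}) \<Rightarrow> bool" where
  "centred_rv M Z \<longleftrightarrow> sq_integrable_rv M Z \<and> integral\<^sup>L M Z = 0"

text \<open>
  \<open>cross_cov M Z W\<close> is the operator \<open>E[Z \<otimes> W]\<close>, where \<open>a \<otimes> b = \<langle>a, \<cdot>\<rangle> b\<close>. The expectation is taken
  after evaluation at a point, since spaces of operators are not separable.
\<close>

definition cross_cov ::
  "'w measure \<Rightarrow> ('w \<Rightarrow> 'd::real_inner) \<Rightarrow> ('w \<Rightarrow> 'e::{banach, second_countable_topology}) \<Rightarrow> 'd \<Rightarrow> 'e" where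
  "cross_cov M Z W = (\<lambda>x. \<integral>\<omega>. (Z \<omega> \<bullet> x) *\<^sub>R W \<omega> \<partial>M)"

definition uncorrelated ::
  "'w measure \<Rightarrow> ('w \<Rightarrow> 'd::{real_inner, banach, second_countable_topology})
    \<Rightarrow> ('w \<Rightarrow> 'e::{real_inner, banach, second_countable_topology}) \<Rightarrow> bool" where
  "uncorrelated M Z W \<longleftrightarrow> centred_rv M Z \<and> centred_rv M W \<and> cross_cov M Z W = (\<lambda>_. 0)"

definition white_noise ::
  "'w measure \<Rightarrow> (int \<Rightarrow> 'w \<Rightarrow> 'e::{real_inner, banach, second_countable_topology}) \<Rightarrow> bool" where
  "white_noise M \<epsilon> \<longleftrightarrow> (\<forall>t. centred_rv M (\<epsilon> t)) \<and> (\<forall>s t. s \<noteq> t \<longrightarrow> uncorrelated M (\<epsilon> s) (\<epsilon> t)) \<and>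
    (\<exists>C. \<forall>t. cross_cov M (\<epsilon> t) (\<epsilon> t) = C)"

text \<open>
  Moving averages of order \<open>q\<close> in \<open>\<real>\<close> or in \<open>L\<^sup>2[0,1]\<close>; the noise may live in \<open>\<real> \<times> L\<^sup>2[0,1]\<close>, so that
  both components of a vector moving average are again moving averages.
\<close>

definition MA_process ::
  "'w measure \<Rightarrow> nat \<Rightarrow> (int \<Rightarrow> 'w \<Rightarrow> 'e::real_normed_vector) \<Rightarrow> bool" where
  "MA_process M q V \<longleftrightarrow>
    (\<exists>(\<epsilon> :: int \<Rightarrow> 'w \<Rightarrow> real \<times> L2_unit) (\<Theta> :: nat \<Rightarrow> (real \<times> L2_unit) \<Rightarrow>\<^sub>L 'e).
      white_noise M \<epsilon> \<and> (\<forall>t. AE \<omega> in M. V t \<omega> = (\<Sum>j\<le>q. blinfun_apply (\<Theta> j) (\<epsilon> (t - int j) \<omega>))))"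

definition uncorrelated_with_history ::
  "'w measure \<Rightarrow> (int \<Rightarrow> 'w \<Rightarrow> 'e::{real_inner, banach, second_countable_topology})
    \<Rightarrow> (int \<Rightarrow> 'w \<Rightarrow> real) \<Rightarrow> (int \<Rightarrow> 'w \<Rightarrow> L2_unit) \<Rightarrow> bool" where
  "uncorrelated_with_history M V y X \<longleftrightarrow>
    (\<forall>t (l::nat). uncorrelated M (V t) (y (t - int l)) \<and> uncorrelated M (V t) (X (t - int l)))"

definition mean_square_sums ::
  "'w measure \<Rightarrow> (nat \<Rightarrow> 'w \<Rightarrow> 'e::real_normed_vector) \<Rightarrow> ('w \<Rightarrow> 'e) \<Rightarrow> bool" where
  "mean_square_sums M f Z \<longleftrightarrow> sq_integrable_rv M Z \<and>
    (\<lambda>n. \<integral>\<omega>. (norm (Z \<omega> - (\<Sum>j<n. f j \<omega>)))\<^sup>2 \<partial>M) \<longlonglongrightarrow> 0"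

section \<open>Operator matrices and structural impulse responses\<close>

lift_definition op_matrix ::
  "(real \<Rightarrow>\<^sub>L real) \<Rightarrow> ('h::real_normed_vector \<Rightarrow>\<^sub>L real) \<Rightarrow> (real \<Rightarrow>\<^sub>L 'h) \<Rightarrow> ('h \<Rightarrow>\<^sub>L 'h)
    \<Rightarrow> (real \<times> 'h) \<Rightarrow>\<^sub>L (real \<times> 'h)" is
  "\<lambda>d11 d12 d21 d22 (y, x). (d11 y + d12 x, d21 y + d22 x)"
  unfolding case_prod_unfold
  by (intro bounded_linear_Pair bounded_linear_add)
    (auto intro: bounded_linear_compose[OF _ bounded_linear_fst] bounded_linear_compose[OF _ bounded_linear_snd])

primrec op_pow :: "('a::real_normed_vector \<Rightarrow>\<^sub>L 'a) \<Rightarrow> nat \<Rightarrow> 'a \<Rightarrow>\<^sub>L 'a" where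
  "op_pow T 0 = id_blinfun"
| "op_pow T (Suc n) = T o\<^sub>L op_pow T n"

text \<open>The coordinate projections are \<^const>\<open>fst_blinfun\<close> and \<^const>\<open>snd_blinfun\<close>; these are their adjoints.\<close>

lift_definition fst_adj :: "real \<Rightarrow>\<^sub>L (real \<times> 'h::real_normed_vector)" is "\<lambda>x. (x, 0)"
  by (intro bounded_linear_Pair bounded_linear_ident bounded_linear_zero)

lift_definition snd_adj :: "'h::real_normed_vector \<Rightarrow>\<^sub>L (real \<times> 'h)" is "\<lambda>x. (0, x)"
  by (intro bounded_linear_Pair bounded_linear_ident bounded_linear_zero)

context
  fixes \<Gamma> Binv :: "(real \<times> 'h::real_normed_vector) \<Rightarrow>\<^sub>L (real \<times> 'h)"
begin

definition SIRF11 :: "nat \<Rightarrow> real \<Rightarrow>\<^sub>L real" where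
  "SIRF11 h = fst_blinfun o\<^sub>L (op_pow \<Gamma> h o\<^sub>L Binv) o\<^sub>L fst_adj"

definition SIRF12 :: "nat \<Rightarrow> 'h \<Rightarrow>\<^sub>L real" where
  "SIRF12 h = fst_blinfun o\<^sub>L (op_pow \<Gamma> h o\<^sub>L Binv) o\<^sub>L snd_adj"

definition SIRF21 :: "nat \<Rightarrow> real \<Rightarrow>\<^sub>L 'h" where
  "SIRF21 h = snd_blinfun o\<^sub>L (op_pow \<Gamma> h o\<^sub>L Binv) o\<^sub>L fst_adj"

definition SIRF22 :: "nat \<Rightarrow> 'h \<Rightarrow>\<^sub>L 'h" where
  "SIRF22 h = snd_blinfun o\<^sub>L (op_pow \<Gamma> h o\<^sub>L Binv) o\<^sub>L snd_adj"

end

end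

theory Submission
  imports Defs
begin

text \<open>
  Iterating the reduced form \<open>h\<close> times writes the state at \<open>t + h\<close> as \<open>\<Gamma>\<^sup>h\<close> applied to the
  state at \<open>t\<close> plus a moving average of the shocks after \<open>t\<close>, which are uncorrelated with the past by
  the mean-square representation. If \<open>\<beta>12 = 0\<close>, then the inverse of \<open>B\<close> fixes \<open>(0, x)\<close>, so the
  coefficient of \<open>X\<close> in the forecast of \<open>y\<close> is already the impulse response, while the first row of the
  model expresses the first shock through \<open>y\<close> and the lagged state, which turns the forecast from
  \<open>t - 1\<close> into the regression of \<open>X\<close>. The case \<open>\<beta>21 = 0\<close> is symmetric. The coefficients are
  unique because the difference of two candidates is a linear map of the current shock that is
  uncorrelated with that shock, which forces its matrix entries to vanish where the shock covariance is
  injective.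
\<close>

section \<open>Riesz representation of bounded functionals\<close>

text \<open>The quadratic functional \<open>g\<close> is bounded below by minus the squared norm of
  \<open>f\<close>, and completeness yields a minimiser \<open>b\<close>; the first variation
  vanishes there, which is \<open>f v = b \<bullet> v\<close>. This turns coefficient functionals
  into vectors and later supplies values of adjoints.\<close>

lemma riesz_representation:
  fixes f :: "'a::{real_inner, complete_space} \<Rightarrow>\<^sub>L real"
  obtains b where "f = blinfun_inner_right b"
proof -
  define g where "g x = (norm x)\<^sup>2 - 2 * f x" for x
  define m where "m = Inf (range g)"
  have "- (norm f)\<^sup>2 \<le> g x" for x
  proof -
    have "f x \<le> norm f * norm x"
      using norm_blinfun[of f x] by (simp add: abs_le_iff)
    then show ?thesis
      using sum_squares_bound[of "norm f" "norm x"] by (simp add: g_def)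
  qed
  then have bdd: "bdd_below (range g)"
    by (intro bdd_belowI[of _ "- (norm f)\<^sup>2"]) auto
  have m_le: "m \<le> g x" for x
    unfolding m_def by (rule cInf_lower[OF _ bdd]) simp
  \<comment> \<open>The linear part of \<open>g\<close> cancels in this combination and the
    parallelogram law remains. Since \<open>g\<close> is at least \<open>m\<close> at the midpoint,
    near-minimisers are close to each other.\<close>
  have parallelogram: "(norm (x - y))\<^sup>2 = 2 * g x + 2 * g y - 4 * g ((1/2) *\<^sub>R (x + y))" for x y
    unfolding g_def power2_norm_eq_inner
    by (simp add: blinfun.bilinear_simps inner_simps inner_commute algebra_simps)
  have "\<exists>x. g x < m + 1 / real (Suc n)" for n
    using cInf_lessD[of "range g" "m + 1 / real (Suc n)"] by (auto simp: m_def)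
  then obtain X where X: "\<And>n. g (X n) < m + 1 / real (Suc n)" by metis
  have "Cauchy X"
  proof (rule metric_CauchyI)
    fix e :: real assume "e > 0"
    \<comment> \<open>Two values of \<open>g\<close> within \<open>1 / real (Suc N)\<close> of
      \<open>m\<close> force a squared distance below four times that number.\<close>
    then obtain N where N: "1 / real (Suc N) < e\<^sup>2 / 4"
      using nat_approx_posE[of "e\<^sup>2 / 4"] by auto
    have le: "1 / real (Suc n) \<le> 1 / real (Suc N)" if "N \<le> n" for n
      using that by (simp add: frac_le)
    have "dist (X i) (X j) < e" if "N \<le> i" "N \<le> j" for i j
    proof -
      have "(norm (X i - X j))\<^sup>2 < e\<^sup>2"
        using parallelogram[of "X i" "X j"] m_le[of "(1/2) *\<^sub>R (X i + X j)"] X[of i] X[of j]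
          le[OF that(1)] le[OF that(2)] N by linarith
      then show ?thesis
        using \<open>e > 0\<close> by (simp add: dist_norm power_less_imp_less_base)
    qed
    then show "\<exists>N. \<forall>i\<ge>N. \<forall>j\<ge>N. dist (X i) (X j) < e" by blast
  qed
  then obtain b where b: "X \<longlonglongrightarrow> b"
    using Cauchy_convergent convergent_def by blast
  have "(\<lambda>n. g (X n)) \<longlonglongrightarrow> g b"
    unfolding g_def by (intro tendsto_intros b)
  moreover have "(\<lambda>n. m + 1 / real (Suc n)) \<longlonglongrightarrow> m + 0"
    by (intro tendsto_intros LIMSEQ_Suc[OF lim_1_over_n])
  ultimately have "g b \<le> m"
    using X by (intro LIMSEQ_le[of "\<lambda>n. g (X n)" _ "\<lambda>n. m + 1 / real (Suc n)"]) (auto intro: less_imp_le)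
  with m_le have min: "g b \<le> g x" for x by (meson order_trans)
  have "f v = b \<bullet> v" for v
  proof (cases "v = 0")
    case True
    then show ?thesis by simp
  next
    case False
    then have v: "v \<bullet> v > 0" by simp
    define c where "c = b \<bullet> v - f v"
    have "g (b + t *\<^sub>R v) = g b + 2 * t * c + t\<^sup>2 * (v \<bullet> v)" for t
      unfolding g_def c_def power2_norm_eq_inner
      by (simp add: blinfun.bilinear_simps inner_simps inner_commute algebra_simps power2_eq_square)
    with min have "0 \<le> 2 * t * c + t\<^sup>2 * (v \<bullet> v)" for t
      by (metis add.assoc le_add_same_cancel1)
    \<comment> \<open>The chosen \<open>t = - c / (v \<bullet> v)\<close> minimises the quadratic in
      \<open>t\<close>, so the inequality is sharpest there.\<close>
    then have "0 \<le> 2 * (- c / (v \<bullet> v)) * c + (- c / (v \<bullet> v))\<^sup>2 * (v \<bullet> v)" .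
    also have "\<dots> = - (c\<^sup>2 / (v \<bullet> v))"
      using v by (simp add: field_simps power2_eq_square)
    finally have "c\<^sup>2 / (v \<bullet> v) \<le> 0" by simp
    with v have "c = 0" by (metis divide_le_0_iff not_less power2_less_eq_zero_iff)
    then show ?thesis by (simp add: c_def)
  qed
  then have "f = blinfun_inner_right b" by (intro blinfun_eqI) simp
  then show thesis by (rule that)
qed

section \<open>Square-integrable random elements and uncorrelatedness\<close>

lemma sq_integrable_rv_measurable [measurable_dest]:
  "sq_integrable_rv M Z \<Longrightarrow> Z \<in> borel_measurable M"
  by (simp add: sq_integrable_rv_def)

lemma borel_measurable_blinfun_apply [measurable]:
  fixes T :: "'d::real_normed_vector \<Rightarrow>\<^sub>L 'e::real_normed_vector"
  shows "blinfun_apply T \<in> borel_measurable borel"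
  by (intro borel_measurable_continuous_onI continuous_intros)

lemma sq_integrable_rv_zero: "sq_integrable_rv M (\<lambda>_. 0)"
  by (simp add: sq_integrable_rv_def)

lemma sq_integrable_rv_blinfun:
  fixes T :: "'d::real_normed_vector \<Rightarrow>\<^sub>L 'e::real_normed_vector"
  assumes Z: "sq_integrable_rv M Z"
  shows "sq_integrable_rv M (\<lambda>\<omega>. T (Z \<omega>))"
  unfolding sq_integrable_rv_def
proof
  note [measurable] = sq_integrable_rv_measurable[OF Z]
  show *: "(\<lambda>\<omega>. T (Z \<omega>)) \<in> borel_measurable M"
    by measurable
  show "integrable M (\<lambda>\<omega>. (norm (T (Z \<omega>)))\<^sup>2)"
  proof (rule Bochner_Integration.integrable_bound)
    show "integrable M (\<lambda>\<omega>. (norm T)\<^sup>2 * (norm (Z \<omega>))\<^sup>2)"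
      using Z by (simp add: sq_integrable_rv_def)
    show "(\<lambda>\<omega>. (norm (T (Z \<omega>)))\<^sup>2) \<in> borel_measurable M" by measurable
    show "AE \<omega> in M. norm ((norm (T (Z \<omega>)))\<^sup>2) \<le> norm ((norm T)\<^sup>2 * (norm (Z \<omega>))\<^sup>2)"
      by (intro AE_I2) (auto simp: power_mult_distrib[symmetric] norm_blinfun intro!: power_mono)
  qed
qed

lemma sq_integrable_rv_add:
  fixes Z W :: "'w \<Rightarrow> 'e::{real_normed_vector, second_countable_topology}"
  assumes Z: "sq_integrable_rv M Z" and W: "sq_integrable_rv M W"
  shows "sq_integrable_rv M (\<lambda>\<omega>. Z \<omega> + W \<omega>)"
  unfolding sq_integrable_rv_def
proof
  note [measurable] = sq_integrable_rv_measurable[OF Z] sq_integrable_rv_measurable[OF W]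
  show "(\<lambda>\<omega>. Z \<omega> + W \<omega>) \<in> borel_measurable M" by measurable
  show "integrable M (\<lambda>\<omega>. (norm (Z \<omega> + W \<omega>))\<^sup>2)"
  proof (rule Bochner_Integration.integrable_bound)
    show "integrable M (\<lambda>\<omega>. 2 * (norm (Z \<omega>))\<^sup>2 + 2 * (norm (W \<omega>))\<^sup>2)"
      using Z W by (simp add: sq_integrable_rv_def)
    show "(\<lambda>\<omega>. (norm (Z \<omega> + W \<omega>))\<^sup>2) \<in> borel_measurable M" by measurable
    have "(norm (x + y))\<^sup>2 \<le> 2 * (norm x)\<^sup>2 + 2 * (norm y)\<^sup>2" for x y :: 'e
    proof -
      have "(norm (x + y))\<^sup>2 \<le> (norm x + norm y)\<^sup>2"
        by (intro power_mono norm_triangle_ineq) simp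
      then show ?thesis
        using sum_squares_bound[of "norm x" "norm y"] by (simp add: power2_sum)
    qed
    then show "AE \<omega> in M. norm ((norm (Z \<omega> + W \<omega>))\<^sup>2) \<le> norm (2 * (norm (Z \<omega>))\<^sup>2 + 2 * (norm (W \<omega>))\<^sup>2)"
      by (intro AE_I2) (auto intro: order_trans[OF _ abs_ge_self])
  qed
qed

lemma sq_integrable_rv_diff:
  fixes Z W :: "'w \<Rightarrow> 'e::{real_normed_vector, second_countable_topology}"
  assumes "sq_integrable_rv M Z" "sq_integrable_rv M W"
  shows "sq_integrable_rv M (\<lambda>\<omega>. Z \<omega> - W \<omega>)"
  using sq_integrable_rv_add[OF assms(1) sq_integrable_rv_blinfun[OF assms(2), of "- id_blinfun"]]
  by (simp add: blinfun.bilinear_simps)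

text \<open>The product of the norms is dominated pointwise by the sum of their squares. This makes
  the cross covariance integrals below exist.\<close>

lemma integrable_scaleR_sq_integrable_rv:
  fixes R :: "'w \<Rightarrow> real" and Z :: "'w \<Rightarrow> 'e::{banach, second_countable_topology}"
  assumes R: "sq_integrable_rv M R" and Z: "sq_integrable_rv M Z"
  shows "integrable M (\<lambda>\<omega>. R \<omega> *\<^sub>R Z \<omega>)"
proof (rule Bochner_Integration.integrable_bound)
  note [measurable] = sq_integrable_rv_measurable[OF R] sq_integrable_rv_measurable[OF Z]
  show "(\<lambda>\<omega>. R \<omega> *\<^sub>R Z \<omega>) \<in> borel_measurable M" by measurable
  show "integrable M (\<lambda>\<omega>. (norm (R \<omega>))\<^sup>2 + (norm (Z \<omega>))\<^sup>2)"
    using R Z by (simp add: sq_integrable_rv_def)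
  have "\<bar>r\<bar> * norm x \<le> r\<^sup>2 + (norm x)\<^sup>2" for r and x :: 'e
  proof -
    have "2 * (\<bar>r\<bar> * norm x) \<le> r\<^sup>2 + (norm x)\<^sup>2"
      using sum_squares_bound[of "\<bar>r\<bar>" "norm x"] by simp
    moreover have "0 \<le> \<bar>r\<bar> * norm x" by simp
    ultimately show ?thesis by linarith
  qed
  then show "AE \<omega> in M. norm (R \<omega> *\<^sub>R Z \<omega>) \<le> norm ((norm (R \<omega>))\<^sup>2 + (norm (Z \<omega>))\<^sup>2)"
    by (intro AE_I2) (auto intro: order_trans[OF _ abs_ge_self])
qed

lemma sq_integrable_rv_inner:
  fixes Z :: "'w \<Rightarrow> 'd::real_inner"
  shows "sq_integrable_rv M Z \<Longrightarrow> sq_integrable_rv M (\<lambda>\<omega>. Z \<omega> \<bullet> x)"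
  using sq_integrable_rv_blinfun[of M Z "blinfun_inner_left x"]
  by (simp add: blinfun_inner_left.rep_eq)

lemma centred_rv_sq_integrable: "centred_rv M Z \<Longrightarrow> sq_integrable_rv M Z"
  by (simp add: centred_rv_def)

section \<open>Calculus of uncorrelated random elements\<close>

context prob_space
begin

lemma integrable_sq_integrable_rv:
  fixes Z :: "'a \<Rightarrow> 'e::{banach, second_countable_topology}"
  assumes "sq_integrable_rv M Z"
  shows "integrable M Z"
proof -
  have "sq_integrable_rv M (\<lambda>_. 1 :: real)" by (simp add: sq_integrable_rv_def)
  from integrable_scaleR_sq_integrable_rv[OF this assms] show ?thesis by simp
qed

lemma centred_rv_zero: "centred_rv M (\<lambda>_. 0)"
  by (simp add: centred_rv_def sq_integrable_rv_zero)

lemma centred_rv_blinfun: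
  fixes T :: "'d::{banach, second_countable_topology} \<Rightarrow>\<^sub>L 'e::{banach, second_countable_topology}"
  assumes "centred_rv M Z"
  shows "centred_rv M (\<lambda>\<omega>. T (Z \<omega>))"
  using assms integral_bounded_linear[OF blinfun.bounded_linear_right integrable_sq_integrable_rv, of Z T]
  by (simp add: centred_rv_def sq_integrable_rv_blinfun)

lemma centred_rv_add:
  "centred_rv M Z \<Longrightarrow> centred_rv M W \<Longrightarrow> centred_rv M (\<lambda>\<omega>. Z \<omega> + W \<omega>)"
  by (simp add: centred_rv_def sq_integrable_rv_add integrable_sq_integrable_rv)

lemma integrable_cross_cov:
  fixes Z :: "'a \<Rightarrow> 'd::real_inner" and W :: "'a \<Rightarrow> 'e::{banach, second_countable_topology}"
  shows "centred_rv M W \<Longrightarrow> sq_integrable_rv M Z \<Longrightarrow> integrable M (\<lambda>\<omega>. (Z \<omega> \<bullet> x) *\<^sub>R W \<omega>)"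
  by (intro integrable_scaleR_sq_integrable_rv sq_integrable_rv_inner) (simp_all add: centred_rv_def)

lemma uncorrelatedI:
  assumes "centred_rv M Z" "centred_rv M W" "\<And>x. (\<integral>\<omega>. (Z \<omega> \<bullet> x) *\<^sub>R W \<omega> \<partial>M) = 0"
  shows "uncorrelated M Z W"
  using assms by (simp add: uncorrelated_def cross_cov_def)

lemma uncorrelatedD:
  assumes "uncorrelated M Z W"
  shows "centred_rv M Z" "centred_rv M W" "(\<integral>\<omega>. (Z \<omega> \<bullet> x) *\<^sub>R W \<omega> \<partial>M) = 0"
    "integrable M (\<lambda>\<omega>. (Z \<omega> \<bullet> x) *\<^sub>R W \<omega>)"
  using assms integrable_cross_cov
  by (auto simp: uncorrelated_def cross_cov_def centred_rv_def fun_eq_iff)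

text \<open>The definition tests only the first element by a functional. Pairing either operator
  with a second test vector gives the same scalar expectation, and a vector orthogonal to itself is
  zero.\<close>

lemma uncorrelated_commute:
  assumes "uncorrelated M Z W"
  shows "uncorrelated M W Z"
proof (rule uncorrelatedI)
  note ZW = uncorrelatedD[OF assms]
  show "centred_rv M W" "centred_rv M Z" by (fact ZW)+
  fix w
  have "(\<integral>\<omega>. (W \<omega> \<bullet> w) *\<^sub>R Z \<omega> \<partial>M) \<bullet> x = 0" for x
  proof -
    have "(\<integral>\<omega>. (W \<omega> \<bullet> w) *\<^sub>R Z \<omega> \<partial>M) \<bullet> x = (\<integral>\<omega>. ((W \<omega> \<bullet> w) *\<^sub>R Z \<omega>) \<bullet> x \<partial>M)"
      by (rule integral_inner_left[symmetric]) (intro integrable_cross_cov ZW(1) centred_rv_sq_integrable ZW(2))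
    also have "\<dots> = (\<integral>\<omega>. ((Z \<omega> \<bullet> x) *\<^sub>R W \<omega>) \<bullet> w \<partial>M)"
      by (simp add: mult.commute)
    also have "\<dots> = 0"
      by (simp only: integral_inner_left[OF ZW(4)] ZW(3) inner_zero_left)
    finally show ?thesis .
  qed
  from this[of "\<integral>\<omega>. (W \<omega> \<bullet> w) *\<^sub>R Z \<omega> \<partial>M"]
  show "(\<integral>\<omega>. (W \<omega> \<bullet> w) *\<^sub>R Z \<omega> \<partial>M) = 0" by simp
qed

lemma uncorrelated_blinfun_right:
  fixes T :: "'d::{real_inner, banach, second_countable_topology} \<Rightarrow>\<^sub>L 'e::{real_inner, banach, second_countable_topology}"
  assumes "uncorrelated M Z W"
  shows "uncorrelated M Z (\<lambda>\<omega>. T (W \<omega>))"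
proof (rule uncorrelatedI)
  note ZW = uncorrelatedD[OF assms]
  show "centred_rv M Z" by (fact ZW)
  show "centred_rv M (\<lambda>\<omega>. T (W \<omega>))" by (intro centred_rv_blinfun ZW)
  fix x
  show "(\<integral>\<omega>. (Z \<omega> \<bullet> x) *\<^sub>R T (W \<omega>) \<partial>M) = 0"
    using integral_bounded_linear[OF blinfun.bounded_linear_right ZW(4), of T x] ZW(3)[of x]
    by (simp add: blinfun.bilinear_simps)
qed

lemma uncorrelated_blinfun_left:
  fixes T :: "'d::{real_inner, banach, second_countable_topology} \<Rightarrow>\<^sub>L 'e::{real_inner, banach, second_countable_topology}"
  shows "uncorrelated M Z W \<Longrightarrow> uncorrelated M (\<lambda>\<omega>. T (Z \<omega>)) W"
  by (rule uncorrelated_commute[OF uncorrelated_blinfun_right[OF uncorrelated_commute]])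

lemma uncorrelated_add_right:
  assumes "uncorrelated M Z V" "uncorrelated M Z W"
  shows "uncorrelated M Z (\<lambda>\<omega>. V \<omega> + W \<omega>)"
proof (rule uncorrelatedI)
  note * = uncorrelatedD[OF assms(1)] uncorrelatedD[OF assms(2)]
  show "centred_rv M Z" "centred_rv M (\<lambda>\<omega>. V \<omega> + W \<omega>)" by (intro centred_rv_add *)+
  show "(\<integral>\<omega>. (Z \<omega> \<bullet> x) *\<^sub>R (V \<omega> + W \<omega>) \<partial>M) = 0" for x
    by (simp add: scaleR_add_right *)
qed

lemma uncorrelated_add_left:
  "uncorrelated M V Z \<Longrightarrow> uncorrelated M W Z \<Longrightarrow> uncorrelated M (\<lambda>\<omega>. V \<omega> + W \<omega>) Z"
  by (rule uncorrelated_commute[OF uncorrelated_add_right[OF uncorrelated_commute uncorrelated_commute]])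

lemma uncorrelated_diff_left:
  assumes "uncorrelated M V Z" "uncorrelated M W Z"
  shows "uncorrelated M (\<lambda>\<omega>. V \<omega> - W \<omega>) Z"
  using uncorrelated_add_left[OF assms(1) uncorrelated_blinfun_left[OF assms(2), of "- id_blinfun"]]
  by (simp add: blinfun.bilinear_simps)

text \<open>Centredness of \<open>Z\<close> is a separate assumption because an empty family carries
  no information about \<open>Z\<close>.\<close>

lemma uncorrelated_sum_left:
  assumes "centred_rv M Z" "\<And>i. i \<in> I \<Longrightarrow> uncorrelated M (V i) Z"
  shows "uncorrelated M (\<lambda>\<omega>. \<Sum>i\<in>I. V i \<omega>) Z"
  using assms(2)
proof (induction I rule: infinite_finite_induct)
  case (insert i I)
  then show ?case by (simp add: uncorrelated_add_left)
qed (auto intro!: uncorrelatedI centred_rv_zero assms(1))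

text \<open>Measurability of \<open>Z'\<close> is asked for because \<open>M\<close> may be
  incomplete. The model equations hold only almost surely, so they are brought into covariances by
  this lemma.\<close>

lemma uncorrelated_cong_AE_left:
  assumes "uncorrelated M Z W" "Z' \<in> borel_measurable M" "AE \<omega> in M. Z' \<omega> = Z \<omega>"
  shows "uncorrelated M Z' W"
proof -
  note ZW = uncorrelatedD[OF assms(1)]
  note [measurable] = assms(2) sq_integrable_rv_measurable[OF centred_rv_sq_integrable[OF ZW(1)]]
    sq_integrable_rv_measurable[OF centred_rv_sq_integrable[OF ZW(2)]]
  have "(\<integral>\<omega>. (Z' \<omega> \<bullet> x) *\<^sub>R W \<omega> \<partial>M) = (\<integral>\<omega>. (Z \<omega> \<bullet> x) *\<^sub>R W \<omega> \<partial>M)" for x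
  proof (rule integral_cong_AE)
    show "AE \<omega> in M. (Z' \<omega> \<bullet> x) *\<^sub>R W \<omega> = (Z \<omega> \<bullet> x) *\<^sub>R W \<omega>"
      using assms(3) by eventually_elim simp
  qed measurable
  moreover have "integral\<^sup>L M Z' = integral\<^sup>L M Z"
    by (rule integral_cong_AE) (use assms(3) in auto)
  moreover have "integrable M (\<lambda>\<omega>. (norm (Z' \<omega>))\<^sup>2) \<longleftrightarrow> integrable M (\<lambda>\<omega>. (norm (Z \<omega>))\<^sup>2)"
    by (rule integrable_cong_AE) (use assms(3) in auto)
  ultimately show ?thesis
    using ZW by (intro uncorrelatedI) (auto simp: centred_rv_def sq_integrable_rv_def)
qed

section \<open>Orthogonality and mean-square limits\<close>

text \<open>Every partial sum contributes zero, so \<open>Z\<close> may be replaced by the remainder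
  \<open>D n\<close>. A weighted Young inequality bounds the result by \<open>c * q\<close> plus the
  mean square of \<open>D n\<close> divided by \<open>c\<close>; first \<open>n\<close> tends to
  infinity, then \<open>c\<close> to zero.\<close>

lemma mean_square_limit_orthogonal:
  fixes Z :: "'a \<Rightarrow> 'e::{banach, second_countable_topology}"
  assumes R: "sq_integrable_rv M R" and Z: "mean_square_sums M f Z"
    and f: "\<And>j. sq_integrable_rv M (f j)" "\<And>j. (\<integral>\<omega>. R \<omega> *\<^sub>R f j \<omega> \<partial>M) = 0"
  shows "(\<integral>\<omega>. R \<omega> *\<^sub>R Z \<omega> \<partial>M) = 0"
proof -
  define D where "D n \<omega> = Z \<omega> - (\<Sum>j<n. f j \<omega>)" for n \<omega>
  define q where "q = (\<integral>\<omega>. (R \<omega>)\<^sup>2 \<partial>M)"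
  have ZS: "sq_integrable_rv M Z" using Z by (simp add: mean_square_sums_def)
  have fS: "sq_integrable_rv M (\<lambda>\<omega>. \<Sum>j<n. f j \<omega>)" for n
    by (induction n) (auto intro!: sq_integrable_rv_zero sq_integrable_rv_add f(1))
  have DS: "sq_integrable_rv M (D n)" for n
    unfolding D_def by (rule sq_integrable_rv_diff[OF ZS fS])
  have "(\<integral>\<omega>. R \<omega> *\<^sub>R Z \<omega> \<partial>M) = (\<integral>\<omega>. R \<omega> *\<^sub>R D n \<omega> \<partial>M)" for n
  proof -
    have "(\<integral>\<omega>. R \<omega> *\<^sub>R D n \<omega> \<partial>M) = (\<integral>\<omega>. R \<omega> *\<^sub>R Z \<omega> - (\<Sum>j<n. R \<omega> *\<^sub>R f j \<omega>) \<partial>M)"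
      by (simp add: D_def scaleR_diff_right scaleR_sum_right)
    also have "\<dots> = (\<integral>\<omega>. R \<omega> *\<^sub>R Z \<omega> \<partial>M) - (\<Sum>j<n. \<integral>\<omega>. R \<omega> *\<^sub>R f j \<omega> \<partial>M)"
      using integrable_scaleR_sq_integrable_rv[OF R ZS] integrable_scaleR_sq_integrable_rv[OF R f(1)]
      by simp
    finally show ?thesis by (simp add: f(2))
  qed
  moreover have "norm (\<integral>\<omega>. R \<omega> *\<^sub>R D n \<omega> \<partial>M) \<le> c * q + (\<integral>\<omega>. (norm (D n \<omega>))\<^sup>2 \<partial>M) / c"
    if c: "c > 0" for c n
  proof -
    \<comment> \<open>The weight is distributed as \<open>sqrt c * \<bar>r\<bar>\<close> and
      \<open>s / sqrt c\<close>, which leaves their product unchanged.\<close>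
    have weighted: "\<bar>r\<bar> * s \<le> c * r\<^sup>2 + s\<^sup>2 / c" if "s \<ge> 0" for r s :: real
    proof -
      have "2 * (\<bar>r\<bar> * s) \<le> c * r\<^sup>2 + s\<^sup>2 / c"
        using sum_squares_bound[of "sqrt c * \<bar>r\<bar>" "s / sqrt c"] c by (simp add: power_mult_distrib power_divide)
      moreover have "0 \<le> \<bar>r\<bar> * s" using that by simp
      ultimately show ?thesis by linarith
    qed
    have "norm (\<integral>\<omega>. R \<omega> *\<^sub>R D n \<omega> \<partial>M) \<le> (\<integral>\<omega>. c * (R \<omega>)\<^sup>2 + (norm (D n \<omega>))\<^sup>2 / c \<partial>M)"
      by (intro order_trans[OF integral_norm_bound integral_mono] integrable_norm integrable_scaleR_sq_integrable_rv[OF R DS])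
        (use R DS[of n] weighted in \<open>auto simp: sq_integrable_rv_def\<close>)
    also have "\<dots> = c * q + (\<integral>\<omega>. (norm (D n \<omega>))\<^sup>2 \<partial>M) / c"
      using R DS[of n] by (simp add: sq_integrable_rv_def q_def)
    finally show ?thesis .
  qed
  ultimately have bound: "norm (\<integral>\<omega>. R \<omega> *\<^sub>R Z \<omega> \<partial>M) \<le> c * q + (\<integral>\<omega>. (norm (D n \<omega>))\<^sup>2 \<partial>M) / c"
    if "c > 0" for c n using that by metis
  have D0: "(\<lambda>n. \<integral>\<omega>. (norm (D n \<omega>))\<^sup>2 \<partial>M) \<longlonglongrightarrow> 0"
    using Z by (simp add: mean_square_sums_def D_def)
  have "norm (\<integral>\<omega>. R \<omega> *\<^sub>R Z \<omega> \<partial>M) \<le> c * q" if c: "c > 0" for c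
  proof -
    have "(\<lambda>n. c * q + (\<integral>\<omega>. (norm (D n \<omega>))\<^sup>2 \<partial>M) / c) \<longlonglongrightarrow> c * q + 0 / c"
      by (intro tendsto_intros D0) (use c in simp)
    then show ?thesis using bound[OF c] by (intro LIMSEQ_le_const) auto
  qed
  \<comment> \<open>The limit is one-sided because the bound is available for positive
    \<open>c\<close> only.\<close>
  moreover have "((\<lambda>c. c * q) \<longlongrightarrow> 0 * q) (at_right 0)" by (intro tendsto_intros)
  ultimately have "norm (\<integral>\<omega>. R \<omega> *\<^sub>R Z \<omega> \<partial>M) \<le> 0 * q"
    by (intro tendsto_lowerbound[of _ _ "at_right 0"]) (auto simp: eventually_at_filter)
  then show ?thesis by simp
qed

text \<open>The mean is the pairing with the constant 1, so the previous lemma applies with that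
  constant as \<open>R\<close>.\<close>

lemma mean_square_sums_centred:
  fixes Z :: "'a \<Rightarrow> 'e::{banach, second_countable_topology}"
  assumes "mean_square_sums M f Z" "\<And>j. centred_rv M (f j)"
  shows "centred_rv M Z"
  using mean_square_limit_orthogonal[of "\<lambda>_. 1", OF _ assms(1)] assms
  by (simp add: centred_rv_def mean_square_sums_def sq_integrable_rv_def)

lemma uncorrelated_mean_square_limit:
  assumes Z: "mean_square_sums M f Z" and W: "centred_rv M W" and f: "\<And>j. uncorrelated M W (f j)"
  shows "uncorrelated M W Z"
proof (rule uncorrelatedI)
  note Wf = uncorrelatedD[OF f]
  show "centred_rv M W" by (rule W)
  show "centred_rv M Z" by (rule mean_square_sums_centred[OF Z Wf(2)])
  show "(\<integral>\<omega>. (W \<omega> \<bullet> x) *\<^sub>R Z \<omega> \<partial>M) = 0" for x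
    by (rule mean_square_limit_orthogonal[OF _ Z _ Wf(3)])
      (intro sq_integrable_rv_inner centred_rv_sq_integrable W Wf(2))+
qed

text \<open>Each scalar projection of \<open>Z\<close> has second moment zero and hence vanishes
  almost surely. The null set may depend on \<open>x\<close>, which is harmless since each
  \<open>x\<close> is tested separately.\<close>

lemma uncorrelated_self_imp_uncorrelated:
  assumes Z: "uncorrelated M Z Z" and W: "centred_rv M W"
  shows "uncorrelated M Z W"
proof (rule uncorrelatedI)
  note ZZ = uncorrelatedD[OF Z]
  show "centred_rv M Z" "centred_rv M W" by (fact ZZ W)+
  fix x
  have "(\<integral>\<omega>. (Z \<omega> \<bullet> x)\<^sup>2 \<partial>M) = (\<integral>\<omega>. ((Z \<omega> \<bullet> x) *\<^sub>R Z \<omega>) \<bullet> x \<partial>M)"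
    by (simp add: power2_eq_square)
  also have "\<dots> = 0"
    by (simp only: integral_inner_left[OF ZZ(4)] ZZ(3) inner_zero_left)
  finally have "AE \<omega> in M. (Z \<omega> \<bullet> x)\<^sup>2 = 0"
    using sq_integrable_rv_inner[OF centred_rv_sq_integrable[OF ZZ(1)], of x]
    by (subst (asm) integral_nonneg_eq_0_iff_AE) (auto simp: sq_integrable_rv_def)
  then have "AE \<omega> in M. (Z \<omega> \<bullet> x) *\<^sub>R W \<omega> = 0"
    by eventually_elim simp
  then show "(\<integral>\<omega>. (Z \<omega> \<bullet> x) *\<^sub>R W \<omega> \<partial>M) = 0"
    by (rule integral_eq_zero_AE)
qed

lemma uncorrelated_Pair_right:
  fixes Y :: "'a \<Rightarrow> real" and X :: "'a \<Rightarrow> 'h::{real_inner, banach, second_countable_topology}"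
  assumes "uncorrelated M W Y" "uncorrelated M W X"
  shows "uncorrelated M W (\<lambda>\<omega>. (Y \<omega>, X \<omega>))"
  using uncorrelated_add_right[OF uncorrelated_blinfun_right[OF assms(1), of fst_adj]
      uncorrelated_blinfun_right[OF assms(2), of snd_adj]]
  by (simp add: fst_adj.rep_eq snd_adj.rep_eq)

end

section \<open>Structural vector autoregressions\<close>

text \<open>Powers are built by factors on the left, whereas the lagged regression inserts one step
  of the recursion on the right.\<close>

lemma op_pow_commute: "op_pow T n o\<^sub>L T = T o\<^sub>L op_pow T n"
proof (induction n)
  case (Suc n)
  then have "op_pow T n (T x) = T (op_pow T n x)" for x
    by (metis blinfun_apply_blinfun_compose)
  then show ?case by (intro blinfun_eqI) simp
qed (auto intro: blinfun_eqI)

text \<open>Both components are bundled into one state \<open>Z\<close>, so that the two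
  identification schemes differ only in the coordinate projections used. No zero restriction on
  \<open>B\<close> is made here; it enters later as \<open>K o\<^sub>L B = K\<close>.\<close>

locale svar = prob_space M for M :: "'w measure" +
  fixes u Z :: "int \<Rightarrow> 'w \<Rightarrow> real \<times> L2_unit"
    and A B Binv \<Gamma> :: "(real \<times> L2_unit) \<Rightarrow>\<^sub>L (real \<times> L2_unit)"
    and \<sigma>11 :: "real \<Rightarrow>\<^sub>L real" and \<Sigma>22 :: "L2_unit \<Rightarrow>\<^sub>L L2_unit"
  assumes centred_shock: "centred_rv M (u t)"
    and uncorrelated_shocks: "s \<noteq> t \<Longrightarrow> uncorrelated M (u s) (u t)"
    and cov_shock: "cross_cov M (u t) (u t) = blinfun_apply (op_matrix \<sigma>11 0 0 \<Sigma>22)"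
    and Binv_B: "Binv o\<^sub>L B = id_blinfun"
    and \<Gamma>_def: "\<Gamma> = Binv o\<^sub>L A"
    and structural: "AE \<omega> in M. B (Z t \<omega>) = A (Z (t - 1) \<omega>) + u t \<omega>"
    and shock_sums: "mean_square_sums M (\<lambda>j \<omega>. (op_pow \<Gamma> j o\<^sub>L Binv) (u (t - int j) \<omega>)) (Z t)"
begin

lemma centred_state: "centred_rv M (Z t)"
  by (rule mean_square_sums_centred[OF shock_sums centred_rv_blinfun[OF centred_shock]])

lemma measurable_model:
  fixes T :: "(real \<times> L2_unit) \<Rightarrow>\<^sub>L 'e::{banach, second_countable_topology}"
  shows "(\<lambda>\<omega>. T (Z t \<omega>)) \<in> borel_measurable M" "(\<lambda>\<omega>. T (u t \<omega>)) \<in> borel_measurable M"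
  by (intro sq_integrable_rv_measurable centred_rv_sq_integrable centred_rv_blinfun centred_state centred_shock)+

text \<open>The series of \<open>Z t\<close> contains only shocks dated \<open>t\<close> or earlier,
  all different from \<open>u s\<close>, and orthogonality survives the mean-square limit.\<close>

lemma uncorrelated_shock_past: "t < s \<Longrightarrow> uncorrelated M (u s) (Z t)"
  by (rule uncorrelated_mean_square_limit[OF shock_sums centred_shock])
    (intro uncorrelated_blinfun_right uncorrelated_shocks, simp)

lemma state_step: "AE \<omega> in M. Z t \<omega> = \<Gamma> (Z (t - 1) \<omega>) + Binv (u t \<omega>)"
  using structural[of t]
proof eventually_elim
  case (elim \<omega>)
  have "Z t \<omega> = (Binv o\<^sub>L B) (Z t \<omega>)" by (simp only: Binv_B blinfun_apply_id_blinfun)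
  with elim show ?case by (simp add: \<Gamma>_def blinfun.bilinear_simps)
qed

section \<open>Forecast errors as moving averages\<close>

text \<open>Since \<open>j < n\<close>, the shocks are dated from \<open>t + 1\<close> to
  \<open>t + n\<close>: this is the part of the state at \<open>t + n\<close> that is uncorrelated
  with the states up to \<open>t\<close>.\<close>

definition forecast_error :: "nat \<Rightarrow> int \<Rightarrow> 'w \<Rightarrow> real \<times> L2_unit" where
  "forecast_error n t \<omega> = (\<Sum>j<n. (op_pow \<Gamma> j o\<^sub>L Binv) (u (t + int n - int j) \<omega>))"

text \<open>The term \<open>j = 0\<close> is the newest shock; each of the others carries one more
  factor \<open>\<Gamma>\<close> than before.\<close>

lemma forecast_error_Suc:
  "forecast_error (Suc n) t \<omega> = Binv (u (t + int (Suc n)) \<omega>) + \<Gamma> (forecast_error n t \<omega>)"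
  unfolding forecast_error_def sum.lessThan_Suc_shift
  by (simp add: blinfun.sum_right algebra_simps)

lemma state_forecast: "AE \<omega> in M. Z (t + int n) \<omega> = op_pow \<Gamma> n (Z t \<omega>) + forecast_error n t \<omega>"
proof (induction n)
  case 0
  show ?case by (simp add: forecast_error_def)
next
  case (Suc n)
  have "t + int (Suc n) - 1 = t + int n" by simp
  with state_step[of "t + int (Suc n)"]
  have "AE \<omega> in M. Z (t + int (Suc n)) \<omega> = \<Gamma> (Z (t + int n) \<omega>) + Binv (u (t + int (Suc n)) \<omega>)" by simp
  with Suc show ?case
    by eventually_elim (simp add: forecast_error_Suc blinfun.bilinear_simps del: of_nat_Suc)
qed

lemma uncorrelated_forecast_error: "s \<le> t \<Longrightarrow> uncorrelated M (forecast_error n t) (Z s)"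
  unfolding forecast_error_def
  by (rule uncorrelated_sum_left[OF centred_state])
    (intro uncorrelated_blinfun_left uncorrelated_shock_past, simp)

text \<open>A moving average uses noise dated at its own index or earlier, while forecast errors at
  \<open>t\<close> use shocks after \<open>t\<close>. Re-indexing the noise by the horizon
  reconciles the two.\<close>

lemma white_noise_shifted: "white_noise M (\<lambda>t. u (t + k))"
  using centred_shock uncorrelated_shocks cov_shock by (auto simp: white_noise_def)

lemma MA_forecast_error:
  fixes T :: "(real \<times> L2_unit) \<Rightarrow>\<^sub>L 'e::real_normed_vector"
  assumes "n \<ge> 1"
  shows "MA_process M (n - 1) (\<lambda>t \<omega>. T (forecast_error n t \<omega>))"
  unfolding MA_process_def
proof (intro exI conjI allI AE_I2)
  show "white_noise M (\<lambda>t. u (t + int n))" by (rule white_noise_shifted)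
  \<comment> \<open>Here \<open>n \<ge> 1\<close> matters: for \<open>n = 0\<close> the truncated
    subtraction would leave one index on the left.\<close>
  have "{..n - 1} = {..<n}" using assms by auto
  then show "T (forecast_error n t \<omega>)
      = (\<Sum>j\<le>n - 1. (T o\<^sub>L (op_pow \<Gamma> j o\<^sub>L Binv)) (u (t - int j + int n) \<omega>))" for t \<omega>
    by (simp add: forecast_error_def blinfun.sum_right algebra_simps)
qed

lemma MA_shock_forecast_error:
  fixes S T :: "(real \<times> L2_unit) \<Rightarrow>\<^sub>L 'e::real_normed_vector"
  shows "MA_process M n (\<lambda>t \<omega>. S (u t \<omega>) + T (forecast_error n t \<omega>))"
  unfolding MA_process_def
proof (intro exI conjI allI AE_I2)
  show "white_noise M (\<lambda>t. u (t + int n))" by (rule white_noise_shifted)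
  \<comment> \<open>In the shifted noise the current shock sits at lag \<open>n\<close>, so
    \<open>S\<close> becomes the last coefficient and the order rises by one.\<close>
  show "S (u t \<omega>) + T (forecast_error n t \<omega>)
      = (\<Sum>j\<le>n. (if j < n then T o\<^sub>L (op_pow \<Gamma> j o\<^sub>L Binv) else S) (u (t - int j + int n) \<omega>))" for t \<omega>
    by (simp add: lessThan_Suc_atMost[symmetric] forecast_error_def blinfun.sum_right algebra_simps)
qed

section \<open>Identification through the shock covariance\<close>

text \<open>This reads off the zero lower left block of the covariance operator by evaluating it at
  \<open>(r, 0)\<close>.\<close>

lemma uncorrelated_shock_components:
  "uncorrelated M (\<lambda>\<omega>. fst (u t \<omega>)) (\<lambda>\<omega>. snd (u t \<omega>))"
proof (rule uncorrelatedI)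
  show "centred_rv M (\<lambda>\<omega>. fst (u t \<omega>))" "centred_rv M (\<lambda>\<omega>. snd (u t \<omega>))"
    using centred_rv_blinfun[OF centred_shock, of fst_blinfun] centred_rv_blinfun[OF centred_shock, of snd_blinfun]
    by simp_all
  fix r :: real
  have "(\<integral>\<omega>. (fst (u t \<omega>) \<bullet> r) *\<^sub>R snd (u t \<omega>) \<partial>M)
      = (\<integral>\<omega>. snd_blinfun ((u t \<omega> \<bullet> (r, 0)) *\<^sub>R u t \<omega>) \<partial>M)"
    by (simp add: inner_prod_def)
  also have "\<dots> = snd_blinfun (cross_cov M (u t) (u t) (r, 0))"
    unfolding cross_cov_def
    by (intro integral_bounded_linear blinfun.bounded_linear_right integrable_cross_cov
        centred_rv_sq_integrable centred_shock)
  finally show "(\<integral>\<omega>. (fst (u t \<omega>) \<bullet> r) *\<^sub>R snd (u t \<omega>) \<partial>M) = 0"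
    by (simp add: cov_shock op_matrix.rep_eq)
qed

text \<open>The adjoint of \<open>T\<close> maps into the kernel of the covariance. That operator is
  block diagonal, so each block can be treated alone, and injectivity of a block removes the
  corresponding column of \<open>T\<close>.\<close>

lemma shock_coefficients_zero:
  fixes T :: "(real \<times> L2_unit) \<Rightarrow>\<^sub>L 'e::{real_inner, banach, second_countable_topology}"
  assumes "uncorrelated M (\<lambda>\<omega>. T (u t \<omega>)) (u t)"
  shows "\<sigma>11 \<noteq> 0 \<Longrightarrow> T o\<^sub>L fst_adj = 0" and "inj \<Sigma>22 \<Longrightarrow> T o\<^sub>L snd_adj = 0"
proof -
  \<comment> \<open>The vector \<open>b\<close> is the adjoint of \<open>T\<close> at
    \<open>x\<close>.\<close>
  have *: "\<exists>b. (\<forall>v. T v \<bullet> x = b \<bullet> v) \<and> \<sigma>11 (fst b) = 0 \<and> \<Sigma>22 (snd b) = 0" for x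
  proof -
    obtain b where "blinfun_inner_left x o\<^sub>L T = blinfun_inner_right b"
      by (rule riesz_representation)
    then have b: "T v \<bullet> x = b \<bullet> v" for v
      by (metis blinfun_apply_blinfun_compose blinfun_inner_left.rep_eq blinfun_inner_right.rep_eq)
    then have "cross_cov M (u t) (u t) b = 0"
      using uncorrelatedD(3)[OF assms, of x] by (simp add: cross_cov_def inner_commute)
    then show ?thesis using b
      by (intro exI[of _ b]) (simp add: cov_shock op_matrix.rep_eq case_prod_unfold zero_prod_def)
  qed
  show "T o\<^sub>L fst_adj = 0" if "\<sigma>11 \<noteq> 0"
  proof (rule blinfun_eqI)
    fix r
    \<comment> \<open>Testing against the value \<open>T (r, 0)\<close> itself turns the pairing at
      \<open>(r, 0)\<close> into its squared norm.\<close>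
    obtain b where b: "\<And>v. T v \<bullet> T (r, 0) = b \<bullet> v" "\<sigma>11 (fst b) = 0"
      using *[of "T (r, 0)"] by blast
    \<comment> \<open>A linear map on the reals is multiplication by its value at 1, so a nonzero
      one is injective.\<close>
    have "\<sigma>11 s = s * \<sigma>11 1" for s
      using blinfun.scaleR_right[of \<sigma>11 s 1] by simp
    with b(2) that have "fst b = 0"
      by (metis blinfun_eqI mult_eq_0_iff mult_zero_right zero_blinfun.rep_eq)
    with b(1)[of "(r, 0)"] show "(T o\<^sub>L fst_adj) r = blinfun_apply 0 r"
      by (simp add: fst_adj.rep_eq inner_prod_def)
  qed
  show "T o\<^sub>L snd_adj = 0" if "inj \<Sigma>22"
  proof (rule blinfun_eqI)
    fix x
    obtain b where b: "\<And>v. T v \<bullet> T (0, x) = b \<bullet> v" "\<Sigma>22 (snd b) = 0"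
      using *[of "T (0, x)"] by blast
    then have "snd b = 0"
      using injD[OF that, of "snd b" 0] by simp
    with b(1)[of "(0, x)"] show "(T o\<^sub>L snd_adj) x = blinfun_apply 0 x"
      by (simp add: snd_adj.rep_eq inner_prod_def)
  qed
qed

text \<open>Subtracting the forecast identity shows that \<open>\<Phi>\<close> maps the state to a
  difference of two errors. This image is therefore uncorrelated with the state, in particular with
  itself, and hence with every centred element of its space.\<close>

lemma current_regression_unique:
  fixes P a :: "(real \<times> L2_unit) \<Rightarrow>\<^sub>L 'e::{real_inner, banach, second_countable_topology}"
  assumes eq: "AE \<omega> in M. P (Z (t + int n) \<omega>) = a (Z t \<omega>) + e \<omega>" and e: "uncorrelated M e (Z t)"
  shows "uncorrelated M (\<lambda>\<omega>. (((P o\<^sub>L op_pow \<Gamma> n) - a) o\<^sub>L Binv) (u t \<omega>)) (u t)"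
proof -
  define \<Phi> where "\<Phi> = (P o\<^sub>L op_pow \<Gamma> n) - a"
  have "uncorrelated M (\<lambda>\<omega>. e \<omega> - P (forecast_error n t \<omega>)) (Z t)"
    by (intro uncorrelated_diff_left e uncorrelated_blinfun_left uncorrelated_forecast_error) simp
  then have \<Phi>Z: "uncorrelated M (\<lambda>\<omega>. \<Phi> (Z t \<omega>)) (Z t)"
  proof (rule uncorrelated_cong_AE_left[OF _ measurable_model(1)])
    show "AE \<omega> in M. \<Phi> (Z t \<omega>) = e \<omega> - P (forecast_error n t \<omega>)"
      using eq state_forecast[of t n]
      by eventually_elim (auto simp: \<Phi>_def blinfun.bilinear_simps algebra_simps)
  qed
  have null: "uncorrelated M (\<lambda>\<omega>. \<Phi> (Z t \<omega>)) W" if "centred_rv M W"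
    for W :: "'w \<Rightarrow> 'e"
    by (rule uncorrelated_self_imp_uncorrelated[OF uncorrelated_blinfun_right[OF \<Phi>Z] that])
  let ?Q = "\<lambda>\<omega>. (\<Phi> o\<^sub>L Binv) (u t \<omega>)"
  \<comment> \<open>The recursion writes the image of the current shock as this difference: the
    first term is degenerate, the second depends only on the past of the shock.\<close>
  have "uncorrelated M (\<lambda>\<omega>. \<Phi> (Z t \<omega>) - (\<Phi> o\<^sub>L \<Gamma>) (Z (t - 1) \<omega>)) ?Q"
    by (intro uncorrelated_diff_left null centred_rv_blinfun centred_shock uncorrelated_blinfun_left
        uncorrelated_blinfun_right uncorrelated_commute[OF uncorrelated_shock_past]) simp
  then have "uncorrelated M ?Q ?Q"
  proof (rule uncorrelated_cong_AE_left[OF _ measurable_model(2)])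
    show "AE \<omega> in M. ?Q \<omega> = \<Phi> (Z t \<omega>) - (\<Phi> o\<^sub>L \<Gamma>) (Z (t - 1) \<omega>)"
      using state_step[of t] by eventually_elim (simp add: blinfun.bilinear_simps)
  qed
  then show ?thesis
    using uncorrelated_self_imp_uncorrelated[OF _ centred_shock] by (simp add: \<Phi>_def)
qed

text \<open>
  A component \<open>K\<close> of the state that does not react to the other one within the period satisfies
  \<open>K B = K\<close>, so that its own shock \<open>K u\<^sub>t\<close> is recovered from \<open>K Z\<^sub>t\<close> and the previous state.
\<close>

lemma own_shock:
  fixes K :: "(real \<times> L2_unit) \<Rightarrow>\<^sub>L 'k::real_normed_vector"
  assumes "K o\<^sub>L B = K"
  shows "AE \<omega> in M. K (u t \<omega>) = K (Z t \<omega>) - (K o\<^sub>L A) (Z (t - 1) \<omega>)"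
  using structural[of t]
proof eventually_elim
  case (elim \<omega>)
  have "K (Z t \<omega>) = (K o\<^sub>L B) (Z t \<omega>)" by (simp only: assms)
  with elim show ?case by (simp add: blinfun.bilinear_simps)
qed

section \<open>Regression on one current component and the lagged state\<close>

text \<open>\<open>K\<close> and \<open>L\<close> select the two components, and \<open>J\<close>,
  \<open>J'\<close> embed them back. The shock \<open>K u\<close> is replaced by \<open>K Z\<close>
  minus its lagged part, so the coefficient of \<open>K Z\<close> is the response to that shock; the
  other shock \<open>L u\<close> stays in the error.\<close>

lemma lagged_regression:
  fixes P :: "(real \<times> L2_unit) \<Rightarrow>\<^sub>L 'e::real_normed_vector"
    and K :: "(real \<times> L2_unit) \<Rightarrow>\<^sub>L 'k::real_normed_vector" and L :: "(real \<times> L2_unit) \<Rightarrow>\<^sub>L 'l::real_normed_vector"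
    and J :: "'k \<Rightarrow>\<^sub>L (real \<times> L2_unit)" and J' :: "'l \<Rightarrow>\<^sub>L (real \<times> L2_unit)"
  assumes K: "K o\<^sub>L B = K" and split: "\<And>v. J (K v) + J' (L v) = v"
  shows "AE \<omega> in M. P (Z (t + int n) \<omega>)
    = (P o\<^sub>L (op_pow \<Gamma> n o\<^sub>L Binv) o\<^sub>L J) (K (Z t \<omega>))
      + ((P o\<^sub>L op_pow \<Gamma> (Suc n)) - (P o\<^sub>L (op_pow \<Gamma> n o\<^sub>L Binv) o\<^sub>L J o\<^sub>L K o\<^sub>L A)) (Z (t - 1) \<omega>)
      + ((P o\<^sub>L (op_pow \<Gamma> n o\<^sub>L Binv) o\<^sub>L J') (L (u t \<omega>)) + P (forecast_error n t \<omega>))"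
  using state_forecast[of t n] state_step[of t] own_shock[OF K, of t]
proof eventually_elim
  case (elim \<omega>)
  have pow: "op_pow \<Gamma> n (\<Gamma> v) = \<Gamma> (op_pow \<Gamma> n v)" for v
    using op_pow_commute[of \<Gamma> n] by (metis blinfun_apply_blinfun_compose)
  define w where "w = J (K (u t \<omega>))"
  have "Binv (u t \<omega>) = Binv w + Binv (J' (L (u t \<omega>)))"
    by (simp add: split w_def flip: blinfun.add_right)
  then have "P (Z (t + int n) \<omega>) = (P o\<^sub>L op_pow \<Gamma> (Suc n)) (Z (t - 1) \<omega>)
      + (P o\<^sub>L (op_pow \<Gamma> n o\<^sub>L Binv)) w
      + ((P o\<^sub>L (op_pow \<Gamma> n o\<^sub>L Binv) o\<^sub>L J') (L (u t \<omega>)) + P (forecast_error n t \<omega>))"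
    unfolding elim(1) elim(2) by (simp add: pow blinfun.add_right add.assoc)
  moreover have "w = J (K (Z t \<omega>)) - J ((K o\<^sub>L A) (Z (t - 1) \<omega>))"
    unfolding w_def elim(3) by (rule blinfun.diff_right)
  ultimately show ?case
    by (simp only: blinfun_apply_blinfun_compose blinfun.diff_right blinfun.diff_left) (simp only: algebra_simps)
qed

text \<open>The error contains the current shock \<open>L u\<close>, so orthogonality is asserted
  only to earlier states and to \<open>K Z\<close>. The latter consists of \<open>K u\<close> and a
  lagged term, both uncorrelated with \<open>L u\<close>.\<close>

lemma lagged_error_uncorrelated:
  fixes S :: "'l::{real_inner, banach, second_countable_topology} \<Rightarrow>\<^sub>L 'e::{real_inner, banach, second_countable_topology}"
    and P :: "(real \<times> L2_unit) \<Rightarrow>\<^sub>L 'e"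
    and K :: "(real \<times> L2_unit) \<Rightarrow>\<^sub>L 'k::{real_inner, banach, second_countable_topology}"
    and L :: "(real \<times> L2_unit) \<Rightarrow>\<^sub>L 'l"
  assumes K: "K o\<^sub>L B = K" and KL: "uncorrelated M (\<lambda>\<omega>. K (u t \<omega>)) (\<lambda>\<omega>. L (u t \<omega>))"
  shows "s < t \<Longrightarrow> uncorrelated M (\<lambda>\<omega>. S (L (u t \<omega>)) + P (forecast_error n t \<omega>)) (Z s)"
    and "uncorrelated M (\<lambda>\<omega>. S (L (u t \<omega>)) + P (forecast_error n t \<omega>)) (\<lambda>\<omega>. K (Z t \<omega>))"
proof -
  show "uncorrelated M (\<lambda>\<omega>. S (L (u t \<omega>)) + P (forecast_error n t \<omega>)) (Z s)" if "s < t" for s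
    using that by (intro uncorrelated_add_left uncorrelated_blinfun_left uncorrelated_shock_past
        uncorrelated_forecast_error) simp_all
  have "uncorrelated M (\<lambda>\<omega>. K (u t \<omega>) + (K o\<^sub>L A) (Z (t - 1) \<omega>)) (\<lambda>\<omega>. L (u t \<omega>))"
    by (intro uncorrelated_add_left KL uncorrelated_blinfun_left uncorrelated_blinfun_right
        uncorrelated_commute[OF uncorrelated_shock_past]) simp
  moreover have "(\<lambda>\<omega>. K (Z t \<omega>)) \<in> borel_measurable M"
    by (rule measurable_model)
  moreover have "AE \<omega> in M. K (Z t \<omega>) = K (u t \<omega>) + (K o\<^sub>L A) (Z (t - 1) \<omega>)"
    using own_shock[OF K, of t] by eventually_elim simp
  ultimately have "uncorrelated M (\<lambda>\<omega>. K (Z t \<omega>)) (\<lambda>\<omega>. L (u t \<omega>))"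
    by (rule uncorrelated_cong_AE_left)
  note LK = uncorrelated_blinfun_left[OF uncorrelated_commute[OF this], of S]
  show "uncorrelated M (\<lambda>\<omega>. S (L (u t \<omega>)) + P (forecast_error n t \<omega>)) (\<lambda>\<omega>. K (Z t \<omega>))"
    by (rule uncorrelated_add_left[OF LK uncorrelated_blinfun_left[OF uncorrelated_blinfun_right[OF
            uncorrelated_forecast_error[OF order_refl]]]])
qed

text \<open>The difference \<open>D\<close> of the two errors is uncorrelated with
  \<open>K Z\<close> and the lagged state, hence with \<open>K u\<close>. It equals
  \<open>(a - C) (K u)\<close> plus a lagged term, so \<open>(a - C) (K u)\<close> is uncorrelated
  with \<open>K u\<close>, and with \<open>L u\<close> because the components are.\<close>

lemma lagged_regression_unique:
  fixes P b :: "(real \<times> L2_unit) \<Rightarrow>\<^sub>L 'e::{real_inner, banach, second_countable_topology}"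
    and K :: "(real \<times> L2_unit) \<Rightarrow>\<^sub>L 'k::{real_inner, banach, second_countable_topology}"
    and L :: "(real \<times> L2_unit) \<Rightarrow>\<^sub>L 'l::{real_inner, banach, second_countable_topology}"
    and J :: "'k \<Rightarrow>\<^sub>L (real \<times> L2_unit)" and J' :: "'l \<Rightarrow>\<^sub>L (real \<times> L2_unit)"
    and a :: "'k \<Rightarrow>\<^sub>L 'e"
  assumes K: "K o\<^sub>L B = K" and split: "\<And>v. J (K v) + J' (L v) = v"
    and KL: "uncorrelated M (\<lambda>\<omega>. K (u t \<omega>)) (\<lambda>\<omega>. L (u t \<omega>))"
    and eq: "AE \<omega> in M. P (Z (t + int n) \<omega>) = a (K (Z t \<omega>)) + b (Z (t - 1) \<omega>) + e \<omega>"
    and e: "uncorrelated M e (\<lambda>\<omega>. K (Z t \<omega>))" "uncorrelated M e (Z (t - 1))"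
  shows "uncorrelated M (\<lambda>\<omega>. ((a - (P o\<^sub>L (op_pow \<Gamma> n o\<^sub>L Binv) o\<^sub>L J)) o\<^sub>L K) (u t \<omega>)) (u t)"
proof -
  define C where "C = P o\<^sub>L (op_pow \<Gamma> n o\<^sub>L Binv) o\<^sub>L J"
  define b0 where "b0 = (P o\<^sub>L op_pow \<Gamma> (Suc n)) - (C o\<^sub>L K o\<^sub>L A)"
  define e0 where "e0 \<omega> = (P o\<^sub>L (op_pow \<Gamma> n o\<^sub>L Binv) o\<^sub>L J') (L (u t \<omega>)) + P (forecast_error n t \<omega>)" for \<omega>
  have e0: "uncorrelated M e0 (\<lambda>\<omega>. K (Z t \<omega>))" "uncorrelated M e0 (Z (t - 1))"
    unfolding e0_def by (rule lagged_error_uncorrelated(2)[OF K KL], rule lagged_error_uncorrelated(1)[OF K KL]) simp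
  define D where "D \<omega> = e0 \<omega> - e \<omega>" for \<omega>
  have D: "uncorrelated M D (\<lambda>\<omega>. K (Z t \<omega>))" "uncorrelated M D (Z (t - 1))"
    unfolding D_def by (intro uncorrelated_diff_left e e0)+
  have "uncorrelated M (\<lambda>\<omega>. K (Z t \<omega>) - (K o\<^sub>L A) (Z (t - 1) \<omega>)) D"
    by (rule uncorrelated_diff_left[OF uncorrelated_commute[OF D(1)]
          uncorrelated_blinfun_left[OF uncorrelated_commute[OF D(2)]]])
  then have "uncorrelated M (\<lambda>\<omega>. K (u t \<omega>)) D"
    by (rule uncorrelated_cong_AE_left[OF _ measurable_model(2) own_shock[OF K]])
  then have DK: "uncorrelated M D (\<lambda>\<omega>. K (u t \<omega>))" by (rule uncorrelated_commute)
  \<comment> \<open>This collects all lagged coefficients of \<open>D\<close> after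
    \<open>K Z\<close> is expressed through \<open>K u\<close> and the previous state.\<close>
  define c where "c = ((a - C) o\<^sub>L K o\<^sub>L A) + (b - b0)"
  let ?Q = "\<lambda>\<omega>. ((a - C) o\<^sub>L K) (u t \<omega>)"
  have "uncorrelated M (\<lambda>\<omega>. D \<omega> - c (Z (t - 1) \<omega>)) (\<lambda>\<omega>. K (u t \<omega>))"
    by (rule uncorrelated_diff_left[OF DK uncorrelated_blinfun_left[OF uncorrelated_blinfun_right[OF
            uncorrelated_commute[OF uncorrelated_shock_past]]]]) simp
  then have QK: "uncorrelated M ?Q (\<lambda>\<omega>. K (u t \<omega>))"
  proof (rule uncorrelated_cong_AE_left[OF _ measurable_model(2)])
    show "AE \<omega> in M. ?Q \<omega> = D \<omega> - c (Z (t - 1) \<omega>)"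
      using eq lagged_regression[OF K split, of P t n] own_shock[OF K, of t]
    proof eventually_elim
      case (elim \<omega>)
      have "D \<omega> = (a - C) (K (Z t \<omega>)) + (b - b0) (Z (t - 1) \<omega>)"
      proof -
        have "P (Z (t + int n) \<omega>) = C (K (Z t \<omega>)) + b0 (Z (t - 1) \<omega>) + e0 \<omega>"
          using elim(2) by (simp only: b0_def C_def e0_def)
        with elim(1) have "e0 \<omega> = a (K (Z t \<omega>)) + b (Z (t - 1) \<omega>) + e \<omega> - (C (K (Z t \<omega>)) + b0 (Z (t - 1) \<omega>))"
          by (metis add_diff_cancel_left')
        then show ?thesis
          unfolding D_def blinfun.diff_left by (simp only: algebra_simps)
      qed
      with elim(3) show ?case
        by (simp add: c_def blinfun.bilinear_simps)
    qed
  qed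
  have QL: "uncorrelated M ?Q (\<lambda>\<omega>. L (u t \<omega>))"
    using uncorrelated_blinfun_left[OF KL, of "a - C"] by simp
  have "uncorrelated M ?Q (\<lambda>\<omega>. J (K (u t \<omega>)) + J' (L (u t \<omega>)))"
    by (rule uncorrelated_add_right[OF uncorrelated_blinfun_right[OF QK] uncorrelated_blinfun_right[OF QL]])
  then show ?thesis by (simp only: split C_def)
qed

end

section \<open>Impulse responses as regression coefficients\<close>

text \<open>Equivalence is stated as existence of a regression with the impulse response as
  coefficient, together with its uniqueness: for \<open>SIRF12\<close> when
  \<open>\<Sigma>22\<close> is injective, for \<open>SIRF21\<close> when \<open>\<sigma>11\<close>
  is nonzero. The lagged regressions omit the current value of the response variable, so its current
  shock remains in the error: \<open>e\<close> has order \<open>h\<close>, and its part of order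
  \<open>h - 1\<close> is the one uncorrelated with the whole history.\<close>

theorem proposition2:
  fixes M :: "'w measure"
    and y u1 :: "int \<Rightarrow> 'w \<Rightarrow> real" and X U2 :: "int \<Rightarrow> 'w \<Rightarrow> L2_unit"
    and u :: "int \<Rightarrow> 'w \<Rightarrow> real \<times> L2_unit"
    and \<alpha>11 :: "real \<Rightarrow>\<^sub>L real" and \<alpha>12 \<beta>12 :: "L2_unit \<Rightarrow>\<^sub>L real"
    and \<alpha>21 \<beta>21 :: "real \<Rightarrow>\<^sub>L L2_unit" and \<alpha>22 :: "L2_unit \<Rightarrow>\<^sub>L L2_unit"
    and \<sigma>11 :: "real \<Rightarrow>\<^sub>L real" and \<Sigma>22 :: "L2_unit \<Rightarrow>\<^sub>L L2_unit"
    and A B Binv \<Gamma> :: "(real \<times> L2_unit) \<Rightarrow>\<^sub>L (real \<times> L2_unit)"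
    and h :: nat
  assumes "prob_space M" and "h \<ge> 1"
    and u: "u = (\<lambda>t \<omega>. (u1 t \<omega>, U2 t \<omega>))"
    and "\<And>t. centred_rv M (u t)"
    and "\<And>s t. s \<noteq> t \<Longrightarrow> uncorrelated M (u s) (u t)"
    and "\<And>t. cross_cov M (u t) (u t) = blinfun_apply (op_matrix \<sigma>11 0 0 \<Sigma>22)"
    and A: "A = op_matrix \<alpha>11 \<alpha>12 \<alpha>21 \<alpha>22"
    and B: "B = op_matrix id_blinfun \<beta>12 \<beta>21 id_blinfun"
    and "Binv o\<^sub>L B = id_blinfun" and "B o\<^sub>L Binv = id_blinfun"
    and \<Gamma>: "\<Gamma> = Binv o\<^sub>L A"
    and "\<And>t. AE \<omega> in M. blinfun_apply B (y t \<omega>, X t \<omega>) = blinfun_apply A (y (t - 1) \<omega>, X (t - 1) \<omega>) + u t \<omega>"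
    and "\<And>t. mean_square_sums M (\<lambda>j \<omega>. blinfun_apply (op_pow \<Gamma> j o\<^sub>L Binv) (u (t - int j) \<omega>)) (\<lambda>\<omega>. (y t \<omega>, X t \<omega>))"
  shows
    "(\<beta>12 = 0 \<longrightarrow>
       (\<exists>(\<alpha>hy :: real) (\<beta>hy :: L2_unit) v.
          SIRF12 \<Gamma> Binv h = blinfun_inner_right \<beta>hy \<and>
          (\<forall>t. AE \<omega> in M. y (t + int h) \<omega> = \<alpha>hy * y t \<omega> + \<beta>hy \<bullet> X t \<omega> + v t \<omega>) \<and>
          MA_process M (h - 1) v \<and> uncorrelated_with_history M v y X) \<and>
       (inj (blinfun_apply \<Sigma>22) \<longrightarrow>
         (\<forall>(\<alpha>hy :: real) (\<beta>hy :: L2_unit) v.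
          (\<forall>t. AE \<omega> in M. y (t + int h) \<omega> = \<alpha>hy * y t \<omega> + \<beta>hy \<bullet> X t \<omega> + v t \<omega>) \<and>
          (\<forall>t. uncorrelated M (v t) (y t) \<and> uncorrelated M (v t) (X t)) \<longrightarrow>
          SIRF12 \<Gamma> Binv h = blinfun_inner_right \<beta>hy)) \<and>
       (\<exists>(\<alpha>hX :: real \<Rightarrow>\<^sub>L L2_unit) (\<beta>hX :: real \<Rightarrow>\<^sub>L L2_unit) (\<gamma>hX :: L2_unit \<Rightarrow>\<^sub>L L2_unit) V e.
          SIRF21 \<Gamma> Binv h = \<alpha>hX \<and>
          (\<forall>t. AE \<omega> in M. X (t + int h) \<omega> = blinfun_apply \<alpha>hX (y t \<omega>) + blinfun_apply \<beta>hX (y (t - 1) \<omega>) + blinfun_apply \<gamma>hX (X (t - 1) \<omega>) + e t \<omega>) \<and>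
          e = (\<lambda>t \<omega>. blinfun_apply (SIRF22 \<Gamma> Binv h) (U2 t \<omega>) + V t \<omega>) \<and>
          MA_process M (h - 1) V \<and> uncorrelated_with_history M V y X \<and>
          MA_process M h e \<and>
          (\<forall>t. uncorrelated M (e t) (y t)) \<and> uncorrelated_with_history M e (\<lambda>t. y (t - 1)) (\<lambda>t. X (t - 1))) \<and>
       (\<sigma>11 \<noteq> 0 \<longrightarrow>
         (\<forall>(\<alpha>hX :: real \<Rightarrow>\<^sub>L L2_unit) (\<beta>hX :: real \<Rightarrow>\<^sub>L L2_unit) (\<gamma>hX :: L2_unit \<Rightarrow>\<^sub>L L2_unit) e.
          (\<forall>t. AE \<omega> in M. X (t + int h) \<omega> = blinfun_apply \<alpha>hX (y t \<omega>) + blinfun_apply \<beta>hX (y (t - 1) \<omega>) + blinfun_apply \<gamma>hX (X (t - 1) \<omega>) + e t \<omega>) \<and>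
          (\<forall>t. uncorrelated M (e t) (y t) \<and> uncorrelated M (e t) (y (t - 1)) \<and> uncorrelated M (e t) (X (t - 1))) \<longrightarrow>
          SIRF21 \<Gamma> Binv h = \<alpha>hX))) \<and>
     (\<beta>21 = 0 \<and> inj (blinfun_apply \<Sigma>22) \<longrightarrow>
       (\<exists>(\<alpha>hy :: L2_unit) (\<beta>hy :: L2_unit) (\<gamma>hy :: real) v e.
          SIRF12 \<Gamma> Binv h = blinfun_inner_right \<alpha>hy \<and>
          (\<forall>t. AE \<omega> in M. y (t + int h) \<omega> = \<alpha>hy \<bullet> X t \<omega> + \<beta>hy \<bullet> X (t - 1) \<omega> + \<gamma>hy * y (t - 1) \<omega> + e t \<omega>) \<and>
          e = (\<lambda>t \<omega>. blinfun_apply (SIRF11 \<Gamma> Binv h) (u1 t \<omega>) + v t \<omega>) \<and>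
          MA_process M (h - 1) v \<and> uncorrelated_with_history M v y X \<and>
          MA_process M h e \<and>
          (\<forall>t. uncorrelated M (e t) (X t)) \<and> uncorrelated_with_history M e (\<lambda>t. y (t - 1)) (\<lambda>t. X (t - 1))) \<and>
       (\<forall>(\<alpha>hy :: L2_unit) (\<beta>hy :: L2_unit) (\<gamma>hy :: real) e.
          (\<forall>t. AE \<omega> in M. y (t + int h) \<omega> = \<alpha>hy \<bullet> X t \<omega> + \<beta>hy \<bullet> X (t - 1) \<omega> + \<gamma>hy * y (t - 1) \<omega> + e t \<omega>) \<and>
          (\<forall>t. uncorrelated M (e t) (X t) \<and> uncorrelated M (e t) (X (t - 1)) \<and> uncorrelated M (e t) (y (t - 1))) \<longrightarrow>
          SIRF12 \<Gamma> Binv h = blinfun_inner_right \<alpha>hy) \<and>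
       (\<exists>(\<alpha>hX :: L2_unit \<Rightarrow>\<^sub>L L2_unit) (\<beta>hX :: real \<Rightarrow>\<^sub>L L2_unit) V.
          SIRF21 \<Gamma> Binv h = \<beta>hX \<and>
          (\<forall>t. AE \<omega> in M. X (t + int h) \<omega> = blinfun_apply \<alpha>hX (X t \<omega>) + blinfun_apply \<beta>hX (y t \<omega>) + V t \<omega>) \<and>
          MA_process M (h - 1) V \<and> uncorrelated_with_history M V y X) \<and>
       (\<sigma>11 \<noteq> 0 \<longrightarrow>
         (\<forall>(\<alpha>hX :: L2_unit \<Rightarrow>\<^sub>L L2_unit) (\<beta>hX :: real \<Rightarrow>\<^sub>L L2_unit) V.
          (\<forall>t. AE \<omega> in M. X (t + int h) \<omega> = blinfun_apply \<alpha>hX (X t \<omega>) + blinfun_apply \<beta>hX (y t \<omega>) + V t \<omega>) \<and>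
          (\<forall>t. uncorrelated M (V t) (X t) \<and> uncorrelated M (V t) (y t)) \<longrightarrow>
          SIRF21 \<Gamma> Binv h = \<beta>hX)))"
proof -
  define Z where "Z = (\<lambda>t \<omega>. (y t \<omega>, X t \<omega>))"
  interpret prob_space M by fact
  interpret svar M u Z A B Binv \<Gamma> \<sigma>11 \<Sigma>22
    by unfold_locales (use assms in \<open>simp_all add: Z_def\<close>)
  have adj [simp]: "fst_adj r = (r, 0)" "snd_adj x = (0, x)" for r :: real and x :: L2_unit
    by (simp_all add: fst_adj.rep_eq snd_adj.rep_eq)
  have y_def: "y t = (\<lambda>\<omega>. fst_blinfun (Z t \<omega>))" and X_def: "X t = (\<lambda>\<omega>. snd_blinfun (Z t \<omega>))"
    and u1_def: "u1 t = (\<lambda>\<omega>. fst_blinfun (u t \<omega>))" and U2_def: "U2 t = (\<lambda>\<omega>. snd_blinfun (u t \<omega>))" for t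
    by (simp_all add: Z_def u)
  have pair: "uncorrelated M W (Z s)" if "uncorrelated M W (y s)" "uncorrelated M W (X s)"
    for s and W :: "'w \<Rightarrow> 'e::{real_inner, banach, second_countable_topology}"
    using uncorrelated_Pair_right[OF that] by (simp add: Z_def)
  have state: "uncorrelated M W (y s)" "uncorrelated M W (X s)" if "uncorrelated M W (Z s)"
    for s and W :: "'w \<Rightarrow> 'e::{real_inner, banach, second_countable_topology}"
    unfolding y_def X_def by (intro uncorrelated_blinfun_right that)+
  have split_state: "T v = T (fst v, 0) + T (0, snd v)"
    for T :: "(real \<times> L2_unit) \<Rightarrow>\<^sub>L 'e::real_normed_vector" and v
    by (simp flip: blinfun.add_right)
  \<comment> \<open>This produces the scalar coefficients: a map restricted to the real component is
    determined by its value at \<open>(1, 0)\<close>.\<close>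
  have real_map: "T (r, 0) = r *\<^sub>R T (1, 0)"
    for T :: "(real \<times> L2_unit) \<Rightarrow>\<^sub>L 'e::real_normed_vector" and r
    by (simp flip: blinfun.scaleR_right)
  have history: "uncorrelated_with_history M (\<lambda>t \<omega>. P (forecast_error h t \<omega>)) y X"
    for P :: "(real \<times> L2_unit) \<Rightarrow>\<^sub>L 'e::{real_inner, banach, second_countable_topology}"
    unfolding uncorrelated_with_history_def
    by (intro allI conjI state uncorrelated_blinfun_left uncorrelated_forecast_error) simp_all
  have shocks: "uncorrelated M (\<lambda>\<omega>. fst_blinfun (u t \<omega>)) (\<lambda>\<omega>. snd_blinfun (u t \<omega>))"
    "uncorrelated M (\<lambda>\<omega>. snd_blinfun (u t \<omega>)) (\<lambda>\<omega>. fst_blinfun (u t \<omega>))" for t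
    using uncorrelated_shock_components[of t] uncorrelated_commute[OF uncorrelated_shock_components[of t]] by simp_all
  have lagged_history: "uncorrelated_with_history M
      (\<lambda>t \<omega>. S (L (u t \<omega>)) + P (forecast_error h t \<omega>)) (\<lambda>t. y (t - 1)) (\<lambda>t. X (t - 1))"
    if "K o\<^sub>L B = K" "\<And>t. uncorrelated M (\<lambda>\<omega>. K (u t \<omega>)) (\<lambda>\<omega>. L (u t \<omega>))"
    for S :: "'l::{real_inner, banach, second_countable_topology} \<Rightarrow>\<^sub>L 'e::{real_inner, banach, second_countable_topology}"
      and L :: "(real \<times> L2_unit) \<Rightarrow>\<^sub>L 'l" and P :: "(real \<times> L2_unit) \<Rightarrow>\<^sub>L 'e"
      and K :: "(real \<times> L2_unit) \<Rightarrow>\<^sub>L 'k::{real_inner, banach, second_countable_topology}"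
    unfolding uncorrelated_with_history_def
    by (intro allI conjI state; rule lagged_error_uncorrelated(1)[OF that]) simp_all
  have lagged_MA: "MA_process M h (\<lambda>t \<omega>. S (L (u t \<omega>)) + P (forecast_error h t \<omega>))"
    for S :: "'l::real_normed_vector \<Rightarrow>\<^sub>L 'e::real_normed_vector"
      and L :: "(real \<times> L2_unit) \<Rightarrow>\<^sub>L 'l" and P :: "(real \<times> L2_unit) \<Rightarrow>\<^sub>L 'e"
    using MA_shock_forecast_error[of h "S o\<^sub>L L" P] by simp
  have MA: "MA_process M (h - 1) (\<lambda>t \<omega>. P (forecast_error h t \<omega>))"
    for P :: "(real \<times> L2_unit) \<Rightarrow>\<^sub>L 'e::real_normed_vector"
    by (rule MA_forecast_error) fact
  have splits: "fst_adj (fst_blinfun v) + snd_adj (snd_blinfun v) = v"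
    "snd_adj (snd_blinfun v) + fst_adj (fst_blinfun v) = v" for v :: "real \<times> L2_unit"
    by simp_all
  have SIRF12_apply: "SIRF12 \<Gamma> Binv h x = fst (op_pow \<Gamma> h (Binv (0, x)))" for x
    by (simp add: SIRF12_def)

  show ?thesis
  proof (intro conjI impI)
    assume \<beta>12: "\<beta>12 = 0"
    \<comment> \<open>With \<open>\<beta>12 = 0\<close> the first row of \<open>B\<close> is the
      projection itself, so \<open>y\<close> plays the role of \<open>K\<close>.\<close>
    have KB: "(fst_blinfun :: (real \<times> L2_unit) \<Rightarrow>\<^sub>L real) o\<^sub>L B = fst_blinfun"
      by (intro blinfun_eqI) (auto simp: B \<beta>12 op_matrix.rep_eq case_prod_unfold)
    have "B (0, x) = (0, x)" for x
      by (simp add: B \<beta>12 op_matrix.rep_eq)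
    then have Binv: "Binv (0, x) = (0, x)" for x
      by (metis Binv_B blinfun_apply_blinfun_compose blinfun_apply_id_blinfun)
    show "\<exists>(\<alpha>hy :: real) (\<beta>hy :: L2_unit) v.
          SIRF12 \<Gamma> Binv h = blinfun_inner_right \<beta>hy \<and>
          (\<forall>t. AE \<omega> in M. y (t + int h) \<omega> = \<alpha>hy * y t \<omega> + \<beta>hy \<bullet> X t \<omega> + v t \<omega>) \<and>
          MA_process M (h - 1) v \<and> uncorrelated_with_history M v y X"
    proof -
      define v where "v t \<omega> = fst_blinfun (forecast_error h t \<omega>)" for t \<omega>
      obtain b where b: "SIRF12 \<Gamma> Binv h = blinfun_inner_right b"
        by (rule riesz_representation)
      then have "fst (op_pow \<Gamma> h (0, x)) = b \<bullet> x" for x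
        by (metis SIRF12_apply Binv blinfun_inner_right.rep_eq)
      then have split: "fst (op_pow \<Gamma> h (Z s \<omega>)) = fst (op_pow \<Gamma> h (1, 0)) * y s \<omega> + b \<bullet> X s \<omega>" for s \<omega>
        using split_state[of "fst_blinfun o\<^sub>L op_pow \<Gamma> h" "Z s \<omega>"]
          real_map[of "fst_blinfun o\<^sub>L op_pow \<Gamma> h" "y s \<omega>"]
        by (simp add: y_def X_def)
      have "AE \<omega> in M. y (t + int h) \<omega> = fst (op_pow \<Gamma> h (1, 0)) * y t \<omega> + b \<bullet> X t \<omega>
          + v t \<omega>" for t
        using state_forecast[of t h] by eventually_elim (simp add: y_def[of "t + _"] split v_def)
      moreover have "MA_process M (h - 1) v" "uncorrelated_with_history M v y X"
        unfolding v_def[abs_def] by (rule MA history)+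
      ultimately show ?thesis using b by blast
    qed
    show "\<forall>(\<alpha>hy :: real) (\<beta>hy :: L2_unit) v.
          (\<forall>t. AE \<omega> in M. y (t + int h) \<omega> = \<alpha>hy * y t \<omega> + \<beta>hy \<bullet> X t \<omega> + v t \<omega>) \<and>
          (\<forall>t. uncorrelated M (v t) (y t) \<and> uncorrelated M (v t) (X t)) \<longrightarrow>
          SIRF12 \<Gamma> Binv h = blinfun_inner_right \<beta>hy"
      if inj: "inj \<Sigma>22"
    proof (intro allI impI, elim conjE)
      fix a b v
      assume eq: "\<forall>t. AE \<omega> in M. y (t + int h) \<omega> = a * y t \<omega> + b \<bullet> X t \<omega> + v t \<omega>"
        and v: "\<forall>t. uncorrelated M (v t) (y t) \<and> uncorrelated M (v t) (X t)"
      \<comment> \<open>Both candidate coefficients are packed into one map on the state. Date 0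
        suffices below, as the coefficients do not depend on time.\<close>
      define T where "T = (a *\<^sub>R fst_blinfun) + (blinfun_inner_right b o\<^sub>L snd_blinfun)"
      have "AE \<omega> in M. fst_blinfun (Z (0 + int h) \<omega>) = T (Z 0 \<omega>) + v 0 \<omega>"
        using eq[rule_format, of 0] by (simp add: T_def y_def X_def blinfun.bilinear_simps)
      from shock_coefficients_zero(2)[OF current_regression_unique[OF this] inj] v
      have zero: "((((fst_blinfun o\<^sub>L op_pow \<Gamma> h) - T) o\<^sub>L Binv) o\<^sub>L snd_adj) = 0"
        by (simp add: pair)
      show "SIRF12 \<Gamma> Binv h = blinfun_inner_right b"
      proof (rule blinfun_eqI)
        fix x
        from arg_cong[OF zero, of "\<lambda>T. blinfun_apply T x"]
        show "SIRF12 \<Gamma> Binv h x = blinfun_inner_right b x"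
          by (simp add: SIRF12_def Binv T_def blinfun.bilinear_simps)
      qed
    qed
    show "\<exists>(\<alpha>hX :: real \<Rightarrow>\<^sub>L L2_unit) (\<beta>hX :: real \<Rightarrow>\<^sub>L L2_unit) (\<gamma>hX :: L2_unit \<Rightarrow>\<^sub>L L2_unit) V e.
          SIRF21 \<Gamma> Binv h = \<alpha>hX \<and>
          (\<forall>t. AE \<omega> in M. X (t + int h) \<omega> = blinfun_apply \<alpha>hX (y t \<omega>) + blinfun_apply \<beta>hX (y (t - 1) \<omega>) + blinfun_apply \<gamma>hX (X (t - 1) \<omega>) + e t \<omega>) \<and>
          e = (\<lambda>t \<omega>. SIRF22 \<Gamma> Binv h (U2 t \<omega>) + V t \<omega>) \<and>
          MA_process M (h - 1) V \<and> uncorrelated_with_history M V y X \<and>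
          MA_process M h e \<and>
          (\<forall>t. uncorrelated M (e t) (y t)) \<and> uncorrelated_with_history M e (\<lambda>t. y (t - 1)) (\<lambda>t. X (t - 1))"
    proof -
      define V where "V t \<omega> = snd_blinfun (forecast_error h t \<omega>)" for t \<omega>
      define e where "e t \<omega> = SIRF22 \<Gamma> Binv h (U2 t \<omega>) + V t \<omega>" for t \<omega>
      \<comment> \<open>The lagged coefficient is obtained as one operator on the pair, common to
        all dates; its two columns become the coefficients of the lagged \<open>y\<close> and
        \<open>X\<close>.\<close>
      obtain b :: "(real \<times> L2_unit) \<Rightarrow>\<^sub>L L2_unit" where b: "\<And>t. AE \<omega> in M. snd_blinfun (Z (t + int h) \<omega>)
          = SIRF21 \<Gamma> Binv h (fst_blinfun (Z t \<omega>)) + b (Z (t - 1) \<omega>) + e t \<omega>"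
        unfolding SIRF21_def SIRF22_def e_def V_def U2_def
        using lagged_regression[OF KB splits(1)] by blast
      have rep: "AE \<omega> in M. X (t + int h) \<omega> = SIRF21 \<Gamma> Binv h (y t \<omega>) + (b o\<^sub>L fst_adj) (y (t - 1) \<omega>)
          + (b o\<^sub>L snd_adj) (X (t - 1) \<omega>) + e t \<omega>" for t
        using b[of t] by eventually_elim (simp add: split_state[of b "Z (t - 1) _"] y_def X_def)
      have shape: "e = (\<lambda>t \<omega>. SIRF22 \<Gamma> Binv h (U2 t \<omega>) + V t \<omega>)"
        by (simp add: e_def[abs_def])
      have MA_fc: "MA_process M (h - 1) V" "uncorrelated_with_history M V y X"
        unfolding V_def[abs_def] by (rule MA history)+
      have MA_e: "MA_process M h e"
        unfolding e_def[abs_def] V_def U2_def by (rule lagged_MA)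
      have unc: "uncorrelated M (e t) (y t)" for t
        unfolding e_def[abs_def] V_def U2_def y_def by (rule lagged_error_uncorrelated(2)[OF KB shocks(1)])
      have hist: "uncorrelated_with_history M e (\<lambda>t. y (t - 1)) (\<lambda>t. X (t - 1))"
        unfolding e_def[abs_def] V_def U2_def by (rule lagged_history[OF KB shocks(1)])
      show ?thesis
        by (rule exI[of _ "SIRF21 \<Gamma> Binv h"],
            rule exI[of _ "b o\<^sub>L fst_adj"],
            rule exI[of _ "b o\<^sub>L snd_adj"],
            rule exI[of _ "V"],
            rule exI[of _ "e"],
            intro conjI allI)
          (fact refl rep shape MA_fc MA_e unc hist)+
    qed
    show "\<forall>(\<alpha>hX :: real \<Rightarrow>\<^sub>L L2_unit) (\<beta>hX :: real \<Rightarrow>\<^sub>L L2_unit) (\<gamma>hX :: L2_unit \<Rightarrow>\<^sub>L L2_unit) e.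
          (\<forall>t. AE \<omega> in M. X (t + int h) \<omega> = blinfun_apply \<alpha>hX (y t \<omega>) + blinfun_apply \<beta>hX (y (t - 1) \<omega>) + blinfun_apply \<gamma>hX (X (t - 1) \<omega>) + e t \<omega>) \<and>
          (\<forall>t. uncorrelated M (e t) (y t) \<and> uncorrelated M (e t) (y (t - 1)) \<and> uncorrelated M (e t) (X (t - 1))) \<longrightarrow>
          SIRF21 \<Gamma> Binv h = \<alpha>hX"
      if \<sigma>: "\<sigma>11 \<noteq> 0"
    proof (intro allI impI, elim conjE)
      fix a b :: "real \<Rightarrow>\<^sub>L L2_unit" and c :: "L2_unit \<Rightarrow>\<^sub>L L2_unit" and e
      assume eq: "\<forall>t. AE \<omega> in M. X (t + int h) \<omega> = a (y t \<omega>) + b (y (t - 1) \<omega>) + c (X (t - 1) \<omega>) + e t \<omega>"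
        and e: "\<forall>t. uncorrelated M (e t) (y t) \<and> uncorrelated M (e t) (y (t - 1)) \<and> uncorrelated M (e t) (X (t - 1))"
      define T where "T = (b o\<^sub>L fst_blinfun) + (c o\<^sub>L snd_blinfun)"
      have "AE \<omega> in M. snd_blinfun (Z (0 + int h) \<omega>) = a (fst_blinfun (Z 0 \<omega>)) + T (Z (0 - 1) \<omega>) + e 0 \<omega>"
        using eq[rule_format, of 0] by (simp add: T_def y_def X_def blinfun.bilinear_simps add.assoc)
      moreover have "uncorrelated M (e 0) (\<lambda>\<omega>. fst_blinfun (Z 0 \<omega>))" "uncorrelated M (e 0) (Z (0 - 1))"
        using e[rule_format, of 0] by (simp_all only: y_def[symmetric] pair)
      ultimately have "uncorrelated M (\<lambda>\<omega>. ((a - SIRF21 \<Gamma> Binv h) o\<^sub>L fst_blinfun) (u 0 \<omega>)) (u 0)"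
        unfolding SIRF21_def by (rule lagged_regression_unique[OF KB splits(1) shocks(1)])
      \<comment> \<open>Restriction to the first coordinate undoes the projection, so the vanishing
        column is \<open>a - SIRF21 \<Gamma> Binv h\<close>.\<close>
      note zero = shock_coefficients_zero(1)[OF this \<sigma>]
      have "(a - SIRF21 \<Gamma> Binv h) r = 0" for r
        using arg_cong[OF zero, of "\<lambda>T. blinfun_apply T r"] by simp
      then show "SIRF21 \<Gamma> Binv h = a"
        by (intro blinfun_eqI) (simp add: blinfun.diff_left)
    qed
  next
    assume "\<beta>21 = 0 \<and> inj \<Sigma>22"
    then have \<beta>21: "\<beta>21 = 0" and inj: "inj \<Sigma>22" by simp_all
    \<comment> \<open>The roles are now exchanged: \<open>X\<close> does not react to
      \<open>y\<close> within the period and serves as \<open>K\<close>.\<close>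
    have KB: "(snd_blinfun :: (real \<times> L2_unit) \<Rightarrow>\<^sub>L L2_unit) o\<^sub>L B = snd_blinfun"
      by (intro blinfun_eqI) (auto simp: B \<beta>21 op_matrix.rep_eq case_prod_unfold)
    have "B (r, 0) = (r, 0)" for r
      by (simp add: B \<beta>21 op_matrix.rep_eq)
    then have Binv: "Binv (r, 0) = (r, 0)" for r
      by (metis Binv_B blinfun_apply_blinfun_compose blinfun_apply_id_blinfun)
    show "\<exists>(\<alpha>hy :: L2_unit) (\<beta>hy :: L2_unit) (\<gamma>hy :: real) v e.
          SIRF12 \<Gamma> Binv h = blinfun_inner_right \<alpha>hy \<and>
          (\<forall>t. AE \<omega> in M. y (t + int h) \<omega> = \<alpha>hy \<bullet> X t \<omega> + \<beta>hy \<bullet> X (t - 1) \<omega> + \<gamma>hy * y (t - 1) \<omega> + e t \<omega>) \<and>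
          e = (\<lambda>t \<omega>. SIRF11 \<Gamma> Binv h (u1 t \<omega>) + v t \<omega>) \<and>
          MA_process M (h - 1) v \<and> uncorrelated_with_history M v y X \<and>
          MA_process M h e \<and>
          (\<forall>t. uncorrelated M (e t) (X t)) \<and> uncorrelated_with_history M e (\<lambda>t. y (t - 1)) (\<lambda>t. X (t - 1))"
    proof -
      define v where "v t \<omega> = fst_blinfun (forecast_error h t \<omega>)" for t \<omega>
      define e where "e t \<omega> = SIRF11 \<Gamma> Binv h (u1 t \<omega>) + v t \<omega>" for t \<omega>
      obtain b :: "(real \<times> L2_unit) \<Rightarrow>\<^sub>L real" where b: "\<And>t. AE \<omega> in M. fst_blinfun (Z (t + int h) \<omega>)
          = SIRF12 \<Gamma> Binv h (snd_blinfun (Z t \<omega>)) + b (Z (t - 1) \<omega>) + e t \<omega>"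
        unfolding SIRF11_def SIRF12_def e_def v_def u1_def
        using lagged_regression[OF KB splits(2)] by blast
      \<comment> \<open>The statement asks for vectors as coefficients of \<open>X\<close>, so both
        the response and the second column of \<open>b\<close> are represented by Riesz.\<close>
      obtain p where p: "SIRF12 \<Gamma> Binv h = blinfun_inner_right p"
        by (rule riesz_representation)
      obtain q where q: "b o\<^sub>L snd_adj = blinfun_inner_right q"
        by (rule riesz_representation)
      have "b (0, x) = q \<bullet> x" for x
        by (metis q adj(2) blinfun_apply_blinfun_compose blinfun_inner_right.rep_eq)
      then have split: "b (Z s \<omega>) = q \<bullet> X s \<omega> + b (1, 0) * y s \<omega>" for s \<omega>
        using split_state[of b "Z s \<omega>"] real_map[of b "y s \<omega>"] by (simp add: y_def X_def)
      have rep: "AE \<omega> in M. y (t + int h) \<omega> = p \<bullet> X t \<omega> + q \<bullet> X (t - 1) \<omega> + b (1, 0) * y (t - 1) \<omega> + e t \<omega>" for t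
        using b[of t] by eventually_elim (simp add: split p y_def[of "t + _"] X_def[of t])
      have shape: "e = (\<lambda>t \<omega>. SIRF11 \<Gamma> Binv h (u1 t \<omega>) + v t \<omega>)"
        by (simp add: e_def[abs_def])
      have MA_fc: "MA_process M (h - 1) v" "uncorrelated_with_history M v y X"
        unfolding v_def[abs_def] by (rule MA history)+
      have MA_e: "MA_process M h e"
        unfolding e_def[abs_def] v_def u1_def by (rule lagged_MA)
      have unc: "uncorrelated M (e t) (X t)" for t
        unfolding e_def[abs_def] v_def u1_def X_def by (rule lagged_error_uncorrelated(2)[OF KB shocks(2)])
      have hist: "uncorrelated_with_history M e (\<lambda>t. y (t - 1)) (\<lambda>t. X (t - 1))"
        unfolding e_def[abs_def] v_def u1_def by (rule lagged_history[OF KB shocks(2)])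
      show ?thesis
        by (rule exI[of _ "p"],
            rule exI[of _ "q"],
            rule exI[of _ "b (1, 0)"],
            rule exI[of _ "v"],
            rule exI[of _ "e"],
            intro conjI allI)
          (fact p rep shape MA_fc MA_e unc hist)+
    qed
    show "\<forall>(\<alpha>hy :: L2_unit) (\<beta>hy :: L2_unit) (\<gamma>hy :: real) e.
          (\<forall>t. AE \<omega> in M. y (t + int h) \<omega> = \<alpha>hy \<bullet> X t \<omega> + \<beta>hy \<bullet> X (t - 1) \<omega> + \<gamma>hy * y (t - 1) \<omega> + e t \<omega>) \<and>
          (\<forall>t. uncorrelated M (e t) (X t) \<and> uncorrelated M (e t) (X (t - 1)) \<and> uncorrelated M (e t) (y (t - 1))) \<longrightarrow>
          SIRF12 \<Gamma> Binv h = blinfun_inner_right \<alpha>hy"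
    proof (intro allI impI, elim conjE)
      fix a b :: L2_unit and c :: real and e
      assume eq: "\<forall>t. AE \<omega> in M. y (t + int h) \<omega> = a \<bullet> X t \<omega> + b \<bullet> X (t - 1) \<omega> + c * y (t - 1) \<omega> + e t \<omega>"
        and e: "\<forall>t. uncorrelated M (e t) (X t) \<and> uncorrelated M (e t) (X (t - 1)) \<and> uncorrelated M (e t) (y (t - 1))"
      define T where "T = (blinfun_inner_right b o\<^sub>L snd_blinfun) + (c *\<^sub>R fst_blinfun)"
      have "AE \<omega> in M. fst_blinfun (Z (0 + int h) \<omega>)
          = blinfun_inner_right a (snd_blinfun (Z 0 \<omega>)) + T (Z (0 - 1) \<omega>) + e 0 \<omega>"
        using eq[rule_format, of 0] by (simp add: T_def y_def X_def blinfun.bilinear_simps add.assoc)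
      moreover have "uncorrelated M (e 0) (\<lambda>\<omega>. snd_blinfun (Z 0 \<omega>))" "uncorrelated M (e 0) (Z (0 - 1))"
        using e[rule_format, of 0] by (simp_all only: X_def[symmetric] pair)
      ultimately have "uncorrelated M (\<lambda>\<omega>. ((blinfun_inner_right a - SIRF12 \<Gamma> Binv h) o\<^sub>L snd_blinfun) (u 0 \<omega>)) (u 0)"
        unfolding SIRF12_def by (rule lagged_regression_unique[OF KB splits(2) shocks(2)])
      note zero = shock_coefficients_zero(2)[OF this inj]
      have "(blinfun_inner_right a - SIRF12 \<Gamma> Binv h) x = 0" for x
        using arg_cong[OF zero, of "\<lambda>T. blinfun_apply T x"] by simp
      then show "SIRF12 \<Gamma> Binv h = blinfun_inner_right a"
        by (intro blinfun_eqI) (simp add: blinfun.diff_left)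
    qed
    show "\<exists>(\<alpha>hX :: L2_unit \<Rightarrow>\<^sub>L L2_unit) (\<beta>hX :: real \<Rightarrow>\<^sub>L L2_unit) V.
          SIRF21 \<Gamma> Binv h = \<beta>hX \<and>
          (\<forall>t. AE \<omega> in M. X (t + int h) \<omega> = blinfun_apply \<alpha>hX (X t \<omega>) + blinfun_apply \<beta>hX (y t \<omega>) + V t \<omega>) \<and>
          MA_process M (h - 1) V \<and> uncorrelated_with_history M V y X"
    proof -
      define V where "V t \<omega> = snd_blinfun (forecast_error h t \<omega>)" for t \<omega>
      \<comment> \<open>As \<open>Binv\<close> fixes \<open>(r, 0)\<close>, the first column of the
        plain forecast operator is already \<open>SIRF21\<close>.\<close>
      have "AE \<omega> in M. X (t + int h) \<omega> = (snd_blinfun o\<^sub>L op_pow \<Gamma> h o\<^sub>L snd_adj) (X t \<omega>)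
          + SIRF21 \<Gamma> Binv h (y t \<omega>) + V t \<omega>" for t
        using state_forecast[of t h]
        by eventually_elim
          (simp add: y_def X_def V_def SIRF21_def Binv split_state[of "op_pow \<Gamma> h" "Z t _"] add.commute)
      moreover have "MA_process M (h - 1) V" "uncorrelated_with_history M V y X"
        unfolding V_def[abs_def] by (rule MA history)+
      ultimately show ?thesis by blast
    qed
    show "\<forall>(\<alpha>hX :: L2_unit \<Rightarrow>\<^sub>L L2_unit) (\<beta>hX :: real \<Rightarrow>\<^sub>L L2_unit) V.
          (\<forall>t. AE \<omega> in M. X (t + int h) \<omega> = blinfun_apply \<alpha>hX (X t \<omega>) + blinfun_apply \<beta>hX (y t \<omega>) + V t \<omega>) \<and>
          (\<forall>t. uncorrelated M (V t) (X t) \<and> uncorrelated M (V t) (y t)) \<longrightarrow>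
          SIRF21 \<Gamma> Binv h = \<beta>hX"
      if \<sigma>: "\<sigma>11 \<noteq> 0"
    proof (intro allI impI, elim conjE)
      fix a :: "L2_unit \<Rightarrow>\<^sub>L L2_unit" and b :: "real \<Rightarrow>\<^sub>L L2_unit" and V
      assume eq: "\<forall>t. AE \<omega> in M. X (t + int h) \<omega> = a (X t \<omega>) + b (y t \<omega>) + V t \<omega>"
        and V: "\<forall>t. uncorrelated M (V t) (X t) \<and> uncorrelated M (V t) (y t)"
      define T where "T = (a o\<^sub>L snd_blinfun) + (b o\<^sub>L fst_blinfun)"
      have "AE \<omega> in M. snd_blinfun (Z (0 + int h) \<omega>) = T (Z 0 \<omega>) + V 0 \<omega>"
        using eq[rule_format, of 0] by (simp add: T_def y_def X_def blinfun.bilinear_simps)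
      from shock_coefficients_zero(1)[OF current_regression_unique[OF this] \<sigma>] V
      have zero: "((((snd_blinfun o\<^sub>L op_pow \<Gamma> h) - T) o\<^sub>L Binv) o\<^sub>L fst_adj) = 0"
        by (simp add: pair)
      show "SIRF21 \<Gamma> Binv h = b"
      proof (rule blinfun_eqI)
        fix r
        from arg_cong[OF zero, of "\<lambda>T. blinfun_apply T r"]
        show "SIRF21 \<Gamma> Binv h r = b r"
          by (simp add: SIRF21_def Binv T_def blinfun.bilinear_simps)
      qed
    qed
  qed
qed

end
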